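(* For every while-program $S\in WP$ and every model $M\models PA$, $A_S^M=C_S^M$, i.e. the X-semantics and the continuous semantics of while-programs coincide.
   Context: **Language.** $L$ is the first-order language with equality and signature $\{+,\cdot,<,0,1\}$ of Peano arithmetic $PA$. $M$ denotes both a model and its domain. All models considered are countable. An assignment over $M$ maps all variables to elements of $M$; $v(\vec a/\vec x)$ is the assignment equal to $v$ except that $\vec x$ is mapped to $\vec a$; $E^{M,v}$ is the value of the term $E$ at $v$. Operations and relations on vectors are componentwise. **Coding functions (definable in $PA$).** $\langle x,y\rangle=\lfloor (x+y+1)(x+y)/2\rfloor+y$, and $L(z),R(z)$ are its inverses: $L(\langle x,y\rangle)=x$, $R(\langle x,y\rangle)=y$, $\langle L(z),R(z)\rangle=z$. Put $\langle x_1,\dots,x_n\rangle=\langle x_1,\langle x_2,\dots,x_n\rangle\rangle$, and let $\overline z$ be the $n$-tuple coded by $z$ ($\overline z=z$ if $n=1$). The extended $\beta$-function $(x)_i$ is the remainder of $L(x)$ on division by $R(x)\cdot(i+1)+1$. **While-programs.** Expressions $E::=0\mid1\mid x\mid E_1+E_2\mid E_1\cdot E_2$; boolean expressions $B::=E_1<E_2\mid\neg B_1\mid B_1\to B_2$; programs $S::=x:=E\mid S_1;S_2\mid if\ B\ then\ S_1\ else\ S_2\ fi\mid while\ B\ do\ S_0\ od$. $WP$ is the set of all programs. $\vec x=(x_1,\dots,x_n)$ lists the program variables of $S$ (the formulas for subprograms of $S$ use the same vector $\vec x$). **Formulas.** For $\vec y=(y_1,\dots,y_n)$ disjoint from $\vec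 x$ define $\alpha_S(\vec x,\vec y)\in L$ by: for $x_i:=E$, $y_i=E(\vec x)\wedge\bigwedge_{j\ne i}y_j=x_j$; for $S_1;S_2$, $\exists\vec z(\alpha_{S_1}(\vec x,\vec z)\wedge\alpha_{S_2}(\vec z,\vec y))$; for the conditional, $(B(\vec x)\wedge\alpha_{S_1}(\vec x,\vec y))\vee(\neg B(\vec x)\wedge\alpha_{S_2}(\vec x,\vec y))$; for $S\equiv while\ B\ do\ S_0\ od$, $\exists i\,\alpha^*_S(i,\vec x,\vec y)\wedge\neg B(\vec y)$, where $\alpha_S^*(i,\vec x,\vec y)::=\exists w\big(\vec x=\overline{(w)_0}\wedge\forall j<i\,(B(\overline{(w)_j})\wedge\alpha_{S_0}(\overline{(w)_j},\overline{(w)_{j+1}}))\wedge\vec y=\overline{(w)_i}\big)$. Also $\varphi_{S_0}(\vec x,y,\vec z)::=\exists w\big(\overline{(w)_0}=\vec x\wedge\forall j<y\ \alpha_{S_0}(\overline{(w)_j},\overline{(w)_{j+1}})\wedge\overline{(w)_y}=\vec z\big)$. **X-semantics.** For $M\models PA$, the binary relation $A_S^M$ on assignments over $M$ is defined by: $(v,v')\in A^M_{x_i:=E}$ iff $v'=v(E^{M,v}/x_i)$; $A^M_{S_1;S_2}$ is the relational composition ($A_{S_1}^M$ first, then $A_{S_2}^M$); $(v,v')\in A^M_{if\,B\,then\,S_1\,else\,S_2\,fi}$ iff ($M,v\models B$ and $(v,v')\in A_{S_1}^M$) or ($M,v\not\models B$ and $(v,v')\in A_{S_2}^M$); and $(v,v')\in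 A^M_{while\,B\,do\,S_0\,od}$ iff there are $i\in M$ and $\vec x_0,\dots,\vec x_i\in M$ (indexed by all $j\le i$ in $M$) such that $M\models\varphi_{S_0}(v(\vec x),j,\vec x_j)$ for all $j\le i$, $v(\vec x)=\vec x_0$, for all $j<i$: $M,v(\vec x_j/\vec x)\models B$ and $(v(\vec x_j/\vec x),v(\vec x_{j+1}/\vec x))\in A_{S_0}^M$, and $v'=v(\vec x_i/\vec x)$, $M,v'\not\models B$. **Continuous semantics.** A sequence $\vec a_0,\dots,\vec a_i$ of vectors of elements of $M$, indexed by the elements $j\le i$ of $M$ (for some $i\in M$), is $M$-continuous if for every formula $\varphi(\vec u,y,\vec z)\in L$ and all $\vec u\in M$: if $M\models\varphi(\vec u,0,\vec a_0)$ and for all $j<i$ in $M$, $M\models\varphi(\vec u,j,\vec a_j)$ implies $M\models\varphi(\vec u,j+1,\vec a_{j+1})$, then $M\models\varphi(\vec u,j,\vec a_j)$ for all $j\le i$. The relation $C_S^M$ on assignments over $M$ is defined by the same clauses as $A_S^M$ (with $C$ in place of $A$) for assignment, composition and conditional, while $(v,v')\in C^M_{while\,B\,do\,S_0\,od}$ iff there is an $M$-continuous sequence $\vec x_0,\dots,\vec x_i\in M$ with $v(\vec x)=\vec x_0$, for all $j<i$: $M,v(\vec x_j/\vec x)\models B$ and $(v(\vec x_j/\vec x),v(\vec x_{j+1}/\vec x))\in C_{S_0}^M$, and $v'=v(\vec x_i/\vec x)$, $M,v'\not\models B$. *)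

theory Defs
  imports "HOL-Library.Countable_Set"
begin

section \<open>The language of arithmetic and its models\<close>

type_synonym var = nat

datatype tm = Zero | One | Var var | Add tm tm | Mul tm tm

datatype fm =
    Eq tm tm | Less tm tm
  | Neg fm | And fm fm | Or fm fm | Imp fm fm
  | All var fm | Ex var fm

text \<open>The domain of a structure is the whole type \<^typ>\<open>'a\<close>; equality is interpreted as
  identity.\<close>

record 'a arith =
  zero_of :: 'a
  one_of :: 'a
  plus_of :: "'a \<Rightarrow> 'a \<Rightarrow> 'a"
  times_of :: "'a \<Rightarrow> 'a \<Rightarrow> 'a"
  less_of :: "'a \<Rightarrow> 'a \<Rightarrow> bool"

type_synonym 'a assignment = "var \<Rightarrow> 'a"

primrec eval :: "'a arith \<Rightarrow> 'a assignment \<Rightarrow> tm \<Rightarrow> 'a" where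
  "eval M v Zero = zero_of M"
| "eval M v One = one_of M"
| "eval M v (Var x) = v x"
| "eval M v (Add s t) = plus_of M (eval M v s) (eval M v t)"
| "eval M v (Mul s t) = times_of M (eval M v s) (eval M v t)"

primrec sat :: "'a arith \<Rightarrow> 'a assignment \<Rightarrow> fm \<Rightarrow> bool" where
  "sat M v (Eq s t) \<longleftrightarrow> eval M v s = eval M v t"
| "sat M v (Less s t) \<longleftrightarrow> less_of M (eval M v s) (eval M v t)"
| "sat M v (Neg f) \<longleftrightarrow> \<not> sat M v f"
| "sat M v (And f g) \<longleftrightarrow> sat M v f \<and> sat M v g"
| "sat M v (Or f g) \<longleftrightarrow> sat M v f \<or> sat M v g"
| "sat M v (Imp f g) \<longleftrightarrow> (sat M v f \<longrightarrow> sat M v g)"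
| "sat M v (All x f) \<longleftrightarrow> (\<forall>a. sat M (v(x := a)) f)"
| "sat M v (Ex x f) \<longleftrightarrow> (\<exists>a. sat M (v(x := a)) f)"

text \<open>A structure is a model of a set of formulas if it satisfies the universal closure of each
  of them.\<close>

definition models :: "'a arith \<Rightarrow> fm set \<Rightarrow> bool" where
  "models M T \<longleftrightarrow> (\<forall>f\<in>T. \<forall>v. sat M v f)"

primrec inst :: "(var \<Rightarrow> tm) \<Rightarrow> tm \<Rightarrow> tm" where
  "inst \<sigma> Zero = Zero"
| "inst \<sigma> One = One"
| "inst \<sigma> (Var x) = \<sigma> x"
| "inst \<sigma> (Add s t) = Add (inst \<sigma> s) (inst \<sigma> t)"
| "inst \<sigma> (Mul s t) = Mul (inst \<sigma> s) (inst \<sigma> t)"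

text \<open>Bound variables are not renamed. This is only used below with a term \<open>t\<close> whose sole possible
  variable is \<open>x\<close> itself, so no capture can occur.\<close>

primrec subst :: "var \<Rightarrow> tm \<Rightarrow> fm \<Rightarrow> fm" where
  "subst x t (Eq s u) = Eq (inst (Var(x := t)) s) (inst (Var(x := t)) u)"
| "subst x t (Less s u) = Less (inst (Var(x := t)) s) (inst (Var(x := t)) u)"
| "subst x t (Neg f) = Neg (subst x t f)"
| "subst x t (And f g) = And (subst x t f) (subst x t g)"
| "subst x t (Or f g) = Or (subst x t f) (subst x t g)"
| "subst x t (Imp f g) = Imp (subst x t f) (subst x t g)"
| "subst x t (All y f) = All y (if y = x then f else subst x t f)"
| "subst x t (Ex y f) = Ex y (if y = x then f else subst x t f)"

definition induction_axiom :: "var \<Rightarrow> fm \<Rightarrow> fm" where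
  "induction_axiom x f =
     Imp (And (subst x Zero f) (All x (Imp f (subst x (Add (Var x) One) f)))) (All x f)"

definition PA :: "fm set" where
  "PA = (let x = Var 0; y = Var 1; z = Var 2 in
     {Neg (Eq (Add x One) Zero),
      Imp (Eq (Add x One) (Add y One)) (Eq x y),
      Eq (Add x Zero) x,
      Eq (Add x (Add y One)) (Add (Add x y) One),
      Eq (Mul x Zero) Zero,
      Eq (Mul x (Add y One)) (Add (Mul x y) x),
      Imp (Less x y) (Ex 2 (Eq (Add x (Add z One)) y)),
      Imp (Ex 2 (Eq (Add x (Add z One)) y)) (Less x y)}
     \<union> {induction_axiom x f | x f. True})"

definition le_of :: "'a arith \<Rightarrow> 'a \<Rightarrow> 'a \<Rightarrow> bool" where
  "le_of M a b \<longleftrightarrow> less_of M a b \<or> a = b"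

definition upd :: "(var \<Rightarrow> 'b) \<Rightarrow> var list \<Rightarrow> 'b list \<Rightarrow> var \<Rightarrow> 'b" where
  "upd v xs as x = (case map_of (zip xs as) x of None \<Rightarrow> v x | Some a \<Rightarrow> a)"

section \<open>While-programs\<close>

datatype bexp = BLess tm tm | BNot bexp | BImp bexp bexp

datatype prog =
    Assign var tm
  | Seq prog prog
  | Cond bexp prog prog
  | While bexp prog

primrec tm_vars :: "tm \<Rightarrow> var list" where
  "tm_vars Zero = []"
| "tm_vars One = []"
| "tm_vars (Var x) = [x]"
| "tm_vars (Add s t) = tm_vars s @ tm_vars t"
| "tm_vars (Mul s t) = tm_vars s @ tm_vars t"

primrec bexp_vars :: "bexp \<Rightarrow> var list" where
  "bexp_vars (BLess s t) = tm_vars s @ tm_vars t"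
| "bexp_vars (BNot b) = bexp_vars b"
| "bexp_vars (BImp b c) = bexp_vars b @ bexp_vars c"

primrec prog_vars :: "prog \<Rightarrow> var set" where
  "prog_vars (Assign x e) = insert x (set (tm_vars e))"
| "prog_vars (Seq S1 S2) = prog_vars S1 \<union> prog_vars S2"
| "prog_vars (Cond b S1 S2) = set (bexp_vars b) \<union> prog_vars S1 \<union> prog_vars S2"
| "prog_vars (While b S0) = set (bexp_vars b) \<union> prog_vars S0"

primrec bexp_fm :: "(var \<Rightarrow> tm) \<Rightarrow> bexp \<Rightarrow> fm" where
  "bexp_fm \<sigma> (BLess s t) = Less (inst \<sigma> s) (inst \<sigma> t)"
| "bexp_fm \<sigma> (BNot b) = Neg (bexp_fm \<sigma> b)"
| "bexp_fm \<sigma> (BImp b c) = Imp (bexp_fm \<sigma> b) (bexp_fm \<sigma> c)"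

definition bsat :: "'a arith \<Rightarrow> 'a assignment \<Rightarrow> bexp \<Rightarrow> bool" where
  "bsat M v b \<longleftrightarrow> sat M v (bexp_fm Var b)"

section \<open>Graphs of the coding functions as formulas\<close>

text \<open>The language has no symbols for the coding functions, so an equation between a coding
  function value and a variable is expressed by a formula defining the graph of the function.
  Quantified variables are taken above all variables of the arguments, starting at \<open>fresh\<close>.\<close>

definition fresh :: "var list \<Rightarrow> var" where
  "fresh xs = Suc (foldr max xs 0)"

definition conjs :: "fm list \<Rightarrow> fm" where
  "conjs fs = foldr And fs (Eq Zero Zero)"

definition exs :: "var list \<Rightarrow> fm \<Rightarrow> fm" where
  "exs xs f = foldr Ex xs f"

text \<open>\<open>z = \<langle>x, y\<rangle>\<close>; the variable \<open>q\<close> is the floor of \<open>(x + y + 1) (x + y) / 2\<close>.\<close>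

definition pair_fm :: "var \<Rightarrow> var \<Rightarrow> var \<Rightarrow> fm" where
  "pair_fm x y z =
     (let q = fresh [x, y, z];
          s = Add (Var x) (Var y);
          p = Mul (Add s One) s;
          q2 = Add (Var q) (Var q)
      in Ex q (And (Or (Eq q2 p) (Eq (Add q2 One) p)) (Eq (Var z) (Add (Var q) (Var y)))))"

text \<open>\<open>us\<close> is the tuple coded by \<open>z\<close>, for nonempty \<open>us\<close>.\<close>

fun tuple_fm :: "var list \<Rightarrow> var \<Rightarrow> fm" where
  "tuple_fm [] z = Eq Zero Zero"
| "tuple_fm [u] z = Eq (Var u) (Var z)"
| "tuple_fm (u # us) z =
     (let r = fresh (z # u # us) in Ex r (And (pair_fm u r z) (tuple_fm us r)))"

text \<open>\<open>r = (w)\<^sub>t\<close>, i.e. \<open>r\<close> is the remainder of \<open>L(w) = l\<close> on division by \<open>R(w) (t + 1) + 1\<close>, where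
  \<open>R(w) = d\<close>.\<close>

definition beta_fm :: "var \<Rightarrow> tm \<Rightarrow> var \<Rightarrow> fm" where
  "beta_fm w t r =
     (let l = fresh (w # r # tm_vars t); d = l + 1; q = l + 2;
          m = Add (Mul (Var d) (Add t One)) One
      in exs [l, d, q] (conjs [pair_fm l d w,
           Eq (Var l) (Add (Mul (Var q) m) (Var r)), Less (Var r) m]))"

text \<open>\<open>us\<close> is the tuple coded by \<open>(w)\<^sub>t\<close>.\<close>

definition entry_fm :: "var list \<Rightarrow> var \<Rightarrow> tm \<Rightarrow> fm" where
  "entry_fm us w t =
     (let c = fresh (w # tm_vars t @ us) in Ex c (And (beta_fm w t c) (tuple_fm us c)))"

text \<open>Some \<open>w\<close> codes a sequence of tuples of length \<open>i + 1\<close> which starts at \<open>us\<close>, ends at \<open>ys\<close>, and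
  whose consecutive entries satisfy the formula \<open>step\<close>. The tuples \<open>as\<close> and \<open>bs\<close> are the entries
  with index \<open>j\<close> and \<open>j + 1\<close>.\<close>

definition run_fm :: "(var list \<Rightarrow> var list \<Rightarrow> fm) \<Rightarrow> var \<Rightarrow> var list \<Rightarrow> var list \<Rightarrow> fm" where
  "run_fm step i us ys =
     (let n = length us;
          w = fresh (i # us @ ys);
          j = w + 1;
          as = [w + 2 ..< w + 2 + n];
          bs = [w + 2 + n ..< w + 2 + 2 * n]
      in Ex w (conjs [
           entry_fm us w Zero,
           All j (Imp (Less (Var j) (Var i))
             (exs (as @ bs) (conjs [
               entry_fm as w (Var j),
               entry_fm bs w (Add (Var j) One),
               step as bs]))),
           entry_fm ys w (Var i)]))"

text \<open>The list \<open>xs\<close> enumerates the program variables. In \<open>alpha xs S us ys\<close> the variables \<open>us\<close> stand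
  for the input values of \<open>xs\<close> and \<open>ys\<close> for the output values; in particular \<open>alpha xs S xs ys\<close> is
  the formula in the program variables themselves.\<close>

definition ren :: "var list \<Rightarrow> var list \<Rightarrow> var \<Rightarrow> tm" where
  "ren xs us = upd Var xs (map Var us)"

primrec alpha :: "var list \<Rightarrow> prog \<Rightarrow> var list \<Rightarrow> var list \<Rightarrow> fm" where
  "alpha xs (Assign x e) us ys =
     conjs (map (\<lambda>j. Eq (Var (ys ! j))
                        (if xs ! j = x then inst (ren xs us) e else Var (us ! j)))
                [0 ..< length xs])"
| "alpha xs (Seq S1 S2) us ys =
     (let m = fresh (us @ ys); zs = [m ..< m + length xs]
      in exs zs (And (alpha xs S1 us zs) (alpha xs S2 zs ys)))"
| "alpha xs (Cond b S1 S2) us ys =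
     Or (And (bexp_fm (ren xs us) b) (alpha xs S1 us ys))
        (And (Neg (bexp_fm (ren xs us) b)) (alpha xs S2 us ys))"
| "alpha xs (While b S0) us ys =
     (let i = fresh (us @ ys)
      in And (Ex i (run_fm (\<lambda>as bs. And (bexp_fm (ren xs as) b) (alpha xs S0 as bs)) i us ys))
             (Neg (bexp_fm (ren xs ys) b)))"

definition phi :: "var list \<Rightarrow> prog \<Rightarrow> var list \<Rightarrow> var \<Rightarrow> var list \<Rightarrow> fm" where
  "phi xs S0 us y zs = run_fm (alpha xs S0) y us zs"

section \<open>X-semantics and continuous semantics\<close>

text \<open>A sequence indexed by the elements \<open>j \<le> i\<close> of a structure is represented by a function on the
  whole domain whose values at other arguments are irrelevant; vectors are lists.\<close>

text \<open>\<open>phi\<close> holds of the values \<open>v(xs)\<close>, \<open>j\<close>, \<open>a\<close>.\<close>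

definition phi_holds ::
  "'a arith \<Rightarrow> var list \<Rightarrow> prog \<Rightarrow> 'a assignment \<Rightarrow> 'a \<Rightarrow> 'a list \<Rightarrow> bool" where
  "phi_holds M xs S0 v j a \<longleftrightarrow>
     (let y = fresh xs; zs = [y + 1 ..< y + 1 + length xs]
      in sat M (upd v (y # zs) (j # a)) (phi xs S0 xs y zs))"

primrec Xsem :: "'a arith \<Rightarrow> var list \<Rightarrow> prog \<Rightarrow> 'a assignment rel" where
  "Xsem M xs (Assign x e) = {(v, v'). v' = v(x := eval M v e)}"
| "Xsem M xs (Seq S1 S2) = Xsem M xs S1 O Xsem M xs S2"
| "Xsem M xs (Cond b S1 S2) =
     {(v, v'). (bsat M v b \<and> (v, v') \<in> Xsem M xs S1) \<or>
               (\<not> bsat M v b \<and> (v, v') \<in> Xsem M xs S2)}"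
| "Xsem M xs (While b S0) =
     {(v, v'). \<exists>i a.
        (\<forall>j. le_of M j i \<longrightarrow> length (a j) = length xs) \<and>
        (\<forall>j. le_of M j i \<longrightarrow> phi_holds M xs S0 v j (a j)) \<and>
        map v xs = a (zero_of M) \<and>
        (\<forall>j. less_of M j i \<longrightarrow>
           bsat M (upd v xs (a j)) b \<and>
           (upd v xs (a j), upd v xs (a (plus_of M j (one_of M)))) \<in> Xsem M xs S0) \<and>
        v' = upd v xs (a i) \<and> \<not> bsat M v' b}"

text \<open>In the definition below, the formula \<open>f\<close> has distinguished distinct variables \<open>y\<close> and \<open>zs\<close>; the
  assignment \<open>u\<close> supplies the values of its remaining free variables (the parameters).\<close>

definition M_continuous :: "'a arith \<Rightarrow> nat \<Rightarrow> 'a \<Rightarrow> ('a \<Rightarrow> 'a list) \<Rightarrow> bool" where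
  "M_continuous M n i a \<longleftrightarrow>
     (\<forall>f y zs u. distinct (y # zs) \<longrightarrow> length zs = n \<longrightarrow>
        sat M (upd u (y # zs) (zero_of M # a (zero_of M))) f \<longrightarrow>
        (\<forall>j. less_of M j i \<longrightarrow>
           sat M (upd u (y # zs) (j # a j)) f \<longrightarrow>
           sat M (upd u (y # zs) (plus_of M j (one_of M) # a (plus_of M j (one_of M)))) f) \<longrightarrow>
        (\<forall>j. le_of M j i \<longrightarrow> sat M (upd u (y # zs) (j # a j)) f))"

primrec Csem :: "'a arith \<Rightarrow> var list \<Rightarrow> prog \<Rightarrow> 'a assignment rel" where
  "Csem M xs (Assign x e) = {(v, v'). v' = v(x := eval M v e)}"
| "Csem M xs (Seq S1 S2) = Csem M xs S1 O Csem M xs S2"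
| "Csem M xs (Cond b S1 S2) =
     {(v, v'). (bsat M v b \<and> (v, v') \<in> Csem M xs S1) \<or>
               (\<not> bsat M v b \<and> (v, v') \<in> Csem M xs S2)}"
| "Csem M xs (While b S0) =
     {(v, v'). \<exists>i a.
        (\<forall>j. le_of M j i \<longrightarrow> length (a j) = length xs) \<and>
        M_continuous M (length xs) i a \<and>
        map v xs = a (zero_of M) \<and>
        (\<forall>j. less_of M j i \<longrightarrow>
           bsat M (upd v xs (a j)) b \<and>
           (upd v xs (a j), upd v xs (a (plus_of M j (one_of M)))) \<in> Csem M xs S0) \<and>
        v' = upd v xs (a i) \<and> \<not> bsat M v' b}"

end

theory Submission
  imports Defs
begin

text \<open>
  The two semantics differ only in the clause for loops, where the formula \<open>\<phi>\<close> says that some code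
  \<open>w\<close> describes a path of length \<open>j\<close> of the body from \<open>v(xs)\<close> to \<open>x\<^sub>j\<close>. Programs are deterministic, and
  induction in \<open>M\<close> shows that two coded paths with the same start agree as long as both are defined.
  Hence if \<open>\<phi>\<close> holds for all \<open>j \<le> i\<close>, a single code for the whole path defines the sequence, and
  definable sequences are continuous by the induction schema. Conversely, \<open>\<phi>\<close> is itself one of the
  formulas that a continuous sequence has to respect: it holds at \<open>0\<close>, and it passes from \<open>j\<close> to
  \<open>j + 1\<close> because a coded path can be extended by one more step. The latter is Goedel's lemma on the
  \<open>\<beta>\<close>-function, which has to be proved inside \<open>M\<close>.
\<close>

section \<open>Peano arithmetic in a model\<close>

lemma eval_inst: "eval M v (inst \<sigma> t) = eval M (\<lambda>x. eval M v (\<sigma> x)) t"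
  by (induction t) auto

lemma eval_inst_single: "eval M v (inst (Var(x := t)) s) = eval M (v(x := eval M v t)) s"
  by (simp add: eval_inst fun_upd_def if_distrib cong: if_cong)

lemma eval_cong: "(\<And>x. x \<in> set (tm_vars t) \<Longrightarrow> v x = v' x) \<Longrightarrow> eval M v t = eval M v' t"
  by (induction t) auto

text \<open>Since \<open>t\<close> has no variable other than \<open>x\<close>, its value does not
  change when a quantifier over another variable updates the assignment, so nothing is captured. A
  quantifier over \<open>x\<close> itself overrides the update of \<open>x\<close>.\<close>

lemma sat_subst:
  "set (tm_vars t) \<subseteq> {x} \<Longrightarrow> sat M v (subst x t f) = sat M (v(x := eval M v t)) f"
proof (induction f arbitrary: v)
  case (All y f)
  then have "eval M (v(y := a)) t = eval M v t" if "y \<noteq> x" for a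
    using that by (intro eval_cong) auto
  with All show ?case by (auto simp: fun_upd_twist simp del: fun_upd_apply)
next
  case (Ex y f)
  then have "eval M (v(y := a)) t = eval M v t" if "y \<noteq> x" for a
    using that by (intro eval_cong) auto
  with Ex show ?case by (auto simp: fun_upd_twist simp del: fun_upd_apply)
qed (auto simp: eval_inst_single)

section \<open>Axioms of arithmetic as facts about the structure\<close>

locale pa_model =
  fixes M :: "'a arith"
  assumes PA: "models M PA"
begin

abbreviation zero_M (\<open>\<zero>\<close>) where "\<zero> \<equiv> zero_of M"
abbreviation one_M (\<open>\<one>\<close>) where "\<one> \<equiv> one_of M"
abbreviation plus_M (infixl \<open>\<oplus>\<close> 65) where "a \<oplus> b \<equiv> plus_of M a b"
abbreviation times_M (infixl \<open>\<otimes>\<close> 70) where "a \<otimes> b \<equiv> times_of M a b"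
abbreviation less_M (infix \<open>\<prec>\<close> 50) where "a \<prec> b \<equiv> less_of M a b"
abbreviation le_M (infix \<open>\<preceq>\<close> 50) where "a \<preceq> b \<equiv> le_of M a b"

lemma sat_PA: "f \<in> PA \<Longrightarrow> sat M v f"
  using PA by (auto simp: models_def)

text \<open>The schema gives induction only for sets definable with parameters. Every use therefore
  exhibits a formula \<open>f\<close> for the property \<open>P\<close>; the assignment
  \<open>v\<close> holds the parameters, often through its constant default value.\<close>

lemma induct_fm:
  assumes P: "\<And>a. P a \<longleftrightarrow> sat M (v(x := a)) f"
    and 0: "P \<zero>" and step: "\<And>a. P a \<Longrightarrow> P (a \<oplus> \<one>)"
  shows "P a"
proof -
  have "sat M v (induction_axiom x f)"
    by (rule sat_PA) (auto simp: PA_def Let_def)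
  with 0 step show ?thesis
    by (simp add: P induction_axiom_def sat_subst)
qed

lemma succ_neq_zero: "a \<oplus> \<one> \<noteq> \<zero>"
  using sat_PA[of "Neg (Eq (Add (Var 0) One) Zero)" "\<lambda>_. a"] by (simp add: PA_def Let_def)

lemma succ_inject: "a \<oplus> \<one> = b \<oplus> \<one> \<longleftrightarrow> a = b"
  using sat_PA[of "Imp (Eq (Add (Var 0) One) (Add (Var 1) One)) (Eq (Var 0) (Var 1))"
      "(\<lambda>_. a)(1 := b)"] by (auto simp: PA_def Let_def)

lemma add_zero: "a \<oplus> \<zero> = a"
  using sat_PA[of "Eq (Add (Var 0) Zero) (Var 0)" "\<lambda>_. a"] by (simp add: PA_def Let_def)

lemma add_succ: "a \<oplus> (b \<oplus> \<one>) = a \<oplus> b \<oplus> \<one>"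
  using sat_PA[of "Eq (Add (Var 0) (Add (Var 1) One)) (Add (Add (Var 0) (Var 1)) One)"
      "(\<lambda>_. a)(1 := b)"] by (simp add: PA_def Let_def)

lemma mult_zero: "a \<otimes> \<zero> = \<zero>"
  using sat_PA[of "Eq (Mul (Var 0) Zero) Zero" "\<lambda>_. a"] by (simp add: PA_def Let_def)

lemma mult_succ: "a \<otimes> (b \<oplus> \<one>) = a \<otimes> b \<oplus> a"
  using sat_PA[of "Eq (Mul (Var 0) (Add (Var 1) One)) (Add (Mul (Var 0) (Var 1)) (Var 0))"
      "(\<lambda>_. a)(1 := b)"] by (simp add: PA_def Let_def)

lemma less_iff: "a \<prec> b \<longleftrightarrow> (\<exists>c. a \<oplus> (c \<oplus> \<one>) = b)"
proof -
  let ?x = "Var 0" and ?y = "Var 1" and ?e = "Ex 2 (Eq (Add (Var 0) (Add (Var 2) One)) (Var 1))"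
  have "sat M ((\<lambda>_. a)(1 := b)) (Imp (Less ?x ?y) ?e)"
    "sat M ((\<lambda>_. a)(1 := b)) (Imp ?e (Less ?x ?y))"
    by (rule sat_PA, simp add: PA_def Let_def)+
  then show ?thesis by auto
qed

section \<open>Addition and multiplication\<close>

lemma add_assoc: "a \<oplus> b \<oplus> c = a \<oplus> (b \<oplus> c)"
  by (rule induct_fm[where P = "\<lambda>c. a \<oplus> b \<oplus> c = a \<oplus> (b \<oplus> c)"
        and v = "(\<lambda>_. a)(1 := b)" and x = 2
        and f = "Eq (Add (Add (Var 0) (Var 1)) (Var 2)) (Add (Var 0) (Add (Var 1) (Var 2)))"])
    (simp_all add: add_zero add_succ)

lemma zero_add: "\<zero> \<oplus> a = a"
  by (rule induct_fm[where v = "\<lambda>_. a" and x = 0 and f = "Eq (Add Zero (Var 0)) (Var 0)"])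
    (simp_all add: add_zero add_succ)

lemma succ_add: "a \<oplus> \<one> \<oplus> b = a \<oplus> b \<oplus> \<one>"
  by (rule induct_fm[where P = "\<lambda>b. a \<oplus> \<one> \<oplus> b = a \<oplus> b \<oplus> \<one>" and v = "\<lambda>_. a" and x = 1
        and f = "Eq (Add (Add (Var 0) One) (Var 1)) (Add (Add (Var 0) (Var 1)) One)"])
    (simp_all add: add_zero add_succ)

lemma add_commute: "a \<oplus> b = b \<oplus> a"
  by (rule induct_fm[where P = "\<lambda>b. a \<oplus> b = b \<oplus> a" and v = "\<lambda>_. a" and x = 1
        and f = "Eq (Add (Var 0) (Var 1)) (Add (Var 1) (Var 0))"])
    (simp_all add: add_zero add_succ zero_add succ_add)

lemma add_cancel: "a \<oplus> c = b \<oplus> c \<longleftrightarrow> a = b"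
  by (rule induct_fm[where P = "\<lambda>c. a \<oplus> c = b \<oplus> c \<longleftrightarrow> a = b" and v = "(\<lambda>_. a)(1 := b)" and x = 2
        and f = "And (Imp (Eq (Add (Var 0) (Var 2)) (Add (Var 1) (Var 2))) (Eq (Var 0) (Var 1)))
                   (Imp (Eq (Var 0) (Var 1)) (Eq (Add (Var 0) (Var 2)) (Add (Var 1) (Var 2))))"])
    (auto simp: add_zero add_succ succ_inject)

lemma zero_or_succ: "a = \<zero> \<or> (\<exists>b. a = b \<oplus> \<one>)"
  by (rule induct_fm[where P = "\<lambda>a. a = \<zero> \<or> (\<exists>b. a = b \<oplus> \<one>)" and v = "\<lambda>_. a" and x = 0
        and f = "Or (Eq (Var 0) Zero) (Ex 1 (Eq (Var 0) (Add (Var 1) One)))"])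
    auto

lemma zero_mult: "\<zero> \<otimes> a = \<zero>"
  by (rule induct_fm[where v = "\<lambda>_. a" and x = 0 and f = "Eq (Mul Zero (Var 0)) Zero"])
    (simp_all add: mult_zero mult_succ add_zero)

lemma succ_mult: "(a \<oplus> \<one>) \<otimes> b = a \<otimes> b \<oplus> b"
proof (rule induct_fm[where P = "\<lambda>b. (a \<oplus> \<one>) \<otimes> b = a \<otimes> b \<oplus> b" and v = "\<lambda>_. a" and x = 1
      and f = "Eq (Mul (Add (Var 0) One) (Var 1)) (Add (Mul (Var 0) (Var 1)) (Var 1))"])
  fix b assume "(a \<oplus> \<one>) \<otimes> b = a \<otimes> b \<oplus> b"
  then show "(a \<oplus> \<one>) \<otimes> (b \<oplus> \<one>) = a \<otimes> (b \<oplus> \<one>) \<oplus> (b \<oplus> \<one>)"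
    by (simp add: mult_succ add_succ) (metis add_assoc add_commute)
qed (simp_all add: mult_zero add_zero)

lemma mult_commute: "a \<otimes> b = b \<otimes> a"
  by (rule induct_fm[where P = "\<lambda>b. a \<otimes> b = b \<otimes> a" and v = "\<lambda>_. a" and x = 1
        and f = "Eq (Mul (Var 0) (Var 1)) (Mul (Var 1) (Var 0))"])
    (simp_all add: mult_zero mult_succ zero_mult succ_mult)

lemma mult_distrib_left: "a \<otimes> (b \<oplus> c) = a \<otimes> b \<oplus> a \<otimes> c"
  by (rule induct_fm[where P = "\<lambda>c. a \<otimes> (b \<oplus> c) = a \<otimes> b \<oplus> a \<otimes> c"
        and v = "(\<lambda>_. a)(1 := b)" and x = 2
        and f = "Eq (Mul (Var 0) (Add (Var 1) (Var 2)))
                   (Add (Mul (Var 0) (Var 1)) (Mul (Var 0) (Var 2)))"])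
    (simp_all add: add_zero mult_zero mult_succ flip: add_assoc)

lemma mult_one: "a \<otimes> \<one> = a"
  by (metis mult_succ mult_zero zero_add)

lemma mult_assoc: "a \<otimes> b \<otimes> c = a \<otimes> (b \<otimes> c)"
  by (rule induct_fm[where P = "\<lambda>c. a \<otimes> b \<otimes> c = a \<otimes> (b \<otimes> c)"
        and v = "(\<lambda>_. a)(1 := b)" and x = 2
        and f = "Eq (Mul (Mul (Var 0) (Var 1)) (Var 2)) (Mul (Var 0) (Mul (Var 1) (Var 2)))"])
    (simp_all add: mult_zero mult_distrib_left mult_one)

section \<open>Order and truncated subtraction\<close>

lemma add_eq_zero: "a \<oplus> b = \<zero> \<Longrightarrow> b = \<zero>"
  using zero_or_succ[of b] by (auto simp: add_succ succ_neq_zero)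

lemma le_iff: "a \<preceq> b \<longleftrightarrow> (\<exists>c. a \<oplus> c = b)"
proof
  assume "\<exists>c. a \<oplus> c = b"
  then obtain c where "a \<oplus> c = b" by blast
  with zero_or_succ[of c] show "a \<preceq> b" by (auto simp: le_of_def less_iff add_zero)
qed (use add_zero in \<open>auto simp: le_of_def less_iff\<close>)

lemma add_left_cancel: "c \<oplus> a = c \<oplus> b \<longleftrightarrow> a = b"
  by (metis add_commute add_cancel)

text \<open>From \<open>a \<prec> b\<close> and \<open>b \<preceq> a\<close>, cancelling
  \<open>a\<close> would leave a sum equal to zero that has a successor as a summand.\<close>

lemma less_le_not_le: "a \<prec> b \<longleftrightarrow> a \<preceq> b \<and> \<not> b \<preceq> a"
proof -
  have "\<not> b \<preceq> a" if ab: "a \<prec> b"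
  proof
    assume "b \<preceq> a"
    then obtain c d where "a \<oplus> (c \<oplus> \<one>) = b" "b \<oplus> d = a"
      using ab by (auto simp: less_iff le_iff)
    then have "a \<oplus> (c \<oplus> \<one>) \<oplus> d = a \<oplus> \<zero>"
      by (simp add: add_zero)
    then have "c \<oplus> \<one> \<oplus> d = \<zero>"
      by (simp only: add_assoc[of a] add_left_cancel)
    then show False
      by (metis add_commute add_eq_zero succ_neq_zero)
  qed
  moreover have "b \<preceq> a" if "a = b"
    using that by (simp add: le_of_def)
  ultimately show ?thesis
    by (auto simp: le_of_def)
qed

text \<open>Induction on \<open>b\<close>: if \<open>b \<prec> a\<close>, the difference is a
  successor, and moving one unit of it to \<open>b\<close> gives
  \<open>b \<oplus> \<one> \<preceq> a\<close>.\<close>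

lemma le_linear: "a \<preceq> b \<or> b \<preceq> a"
proof (rule induct_fm[where P = "\<lambda>b. a \<preceq> b \<or> b \<preceq> a" and v = "\<lambda>_. a" and x = 1
      and f = "Or (Ex 2 (Eq (Add (Var 0) (Var 2)) (Var 1))) (Ex 2 (Eq (Add (Var 1) (Var 2)) (Var 0)))"])
  fix b assume "a \<preceq> b \<or> b \<preceq> a"
  then consider c where "a \<oplus> c = b" | c where "b \<oplus> (c \<oplus> \<one>) = a"
    by (auto simp: le_of_def less_iff intro: add_zero)
  then show "a \<preceq> b \<oplus> \<one> \<or> b \<oplus> \<one> \<preceq> a"
  proof cases
    case 1
    then show ?thesis by (metis add_assoc le_iff)
  next
    case 2
    then show ?thesis by (metis add_succ succ_add le_iff)
  qed
qed (auto simp: le_iff zero_add)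

text \<open>Subtraction is not in the language. It is introduced because ordered semidomains come
  with a minus operation; cutting off at zero makes \<open>minus_minus\<close> and
  \<open>mult_minus\<close> hold for all arguments.\<close>

definition minus_M (infixl \<open>\<ominus>\<close> 65) where
  "a \<ominus> b = (if b \<preceq> a then THE c. b \<oplus> c = a else \<zero>)"

lemma add_minus: "a \<oplus> b \<ominus> a = b"
  unfolding minus_M_def using le_iff by (auto simp: add_left_cancel)

lemma minus_not_le: "\<not> b \<preceq> a \<Longrightarrow> a \<ominus> b = \<zero>"
  by (simp add: minus_M_def)

lemma le_refl: "a \<preceq> a"
  by (simp add: le_of_def)

lemma le_trans: "a \<preceq> b \<Longrightarrow> b \<preceq> c \<Longrightarrow> a \<preceq> c"
  by (metis le_iff add_assoc)

lemma le_antisym: "a \<preceq> b \<Longrightarrow> b \<preceq> a \<Longrightarrow> a = b"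
  by (metis less_le_not_le le_of_def)

lemma add_left_mono: "a \<preceq> b \<Longrightarrow> c \<oplus> a \<preceq> c \<oplus> b"
  by (metis le_iff add_assoc)

lemma add_le_cancel: "c \<oplus> a \<preceq> c \<oplus> b \<Longrightarrow> a \<preceq> b"
  by (metis le_iff add_assoc add_left_cancel)

lemma minus_eq_zero: "a \<preceq> b \<Longrightarrow> a \<ominus> b = \<zero>"
  by (metis add_minus add_zero le_antisym minus_not_le)

lemma minus_minus: "a \<ominus> b \<ominus> c = a \<ominus> (b \<oplus> c)"
proof (cases "b \<preceq> a")
  case True
  then obtain d where d: "a = b \<oplus> d" by (auto simp: le_iff)
  show ?thesis
  proof (cases "c \<preceq> d")
    case True
    then obtain e where "d = c \<oplus> e" by (auto simp: le_iff)
    with d show ?thesis by (metis add_assoc add_minus)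
  next
    case False
    with d have "\<not> b \<oplus> c \<preceq> a" by (metis add_le_cancel)
    with d False show ?thesis by (simp add: add_minus minus_not_le)
  qed
next
  case False
  then have "\<not> b \<oplus> c \<preceq> a"
    by (metis le_iff add_assoc)
  with False show ?thesis
    by (metis minus_not_le minus_eq_zero le_iff zero_add)
qed

lemma mult_minus: "a \<otimes> (b \<ominus> c) = a \<otimes> b \<ominus> a \<otimes> c"
proof (cases "c \<preceq> b")
  case True
  then show ?thesis by (metis le_iff add_minus mult_distrib_left)
next
  case False
  then obtain d where "c = b \<oplus> d" using le_linear le_iff by metis
  then have "a \<otimes> b \<preceq> a \<otimes> c" by (auto simp: mult_distrib_left le_iff)
  with False show ?thesis by (simp add: minus_not_le minus_eq_zero mult_zero)
qed

lemma mult_pos_mono: "a \<prec> b \<Longrightarrow> \<zero> \<prec> c \<Longrightarrow> c \<otimes> a \<prec> c \<otimes> b"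
proof -
  assume "a \<prec> b" "\<zero> \<prec> c"
  then obtain d e where "b = a \<oplus> (d \<oplus> \<one>)" "c = e \<oplus> \<one>"
    by (auto simp: less_iff zero_add)
  \<comment> \<open>With \<open>c = e \<oplus> \<one>\<close>, the difference of the two products is
    \<open>c \<otimes> (d \<oplus> \<one>)\<close>, the successor of
    \<open>c \<otimes> d \<oplus> e\<close>.\<close>
  then show ?thesis
    by (auto simp: mult_distrib_left less_iff mult_one add_assoc
        intro!: exI[of _ "c \<otimes> d \<oplus> e"])
qed

text \<open>Makes the general algebra and order facts about ordered semidomains available in the
  structure, under the prefix \<open>ar\<close>.\<close>

sublocale ar: linordered_semidom
  where zero = \<zero> and one = \<one> and plus = "plus_of M" and times = "times_of M"
    and less = "less_of M" and less_eq = "le_of M" and minus = minus_M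
proof unfold_locales
  show "\<zero> \<noteq> \<one>"
    by (metis succ_neq_zero zero_add)
  show "\<zero> \<prec> \<one>"
    by (auto simp: less_iff zero_add intro: exI[of _ \<zero>])
  show "a \<otimes> b \<noteq> \<zero>" if "a \<noteq> \<zero>" "b \<noteq> \<zero>" for a b
    using that zero_or_succ[of a] zero_or_succ[of b]
    by (auto simp: mult_succ add_succ succ_neq_zero)
  show "a \<ominus> b \<oplus> b = a" if "b \<preceq> a" for a b
    using that by (metis le_iff add_minus add_commute)
qed (fact add_assoc add_commute add_minus minus_minus less_le_not_le le_refl le_trans le_antisym
      add_left_mono le_linear mult_assoc mult_commute zero_mult mult_zero mult_minus mult_pos_mono
    | simp add: zero_add add_zero mult_one mult_distrib_left mult_commute add_commute; fail
    | metis mult_one mult_commute mult_distrib_left zero_add add_le_cancel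
          mult_minus succ_neq_zero)+

text \<open>Otherwise sums of \<open>\<one>\<close> become numerals, which \<open>algebra_simps\<close> does not normalize here.\<close>

declare ar.one_add_one [simp del]

section \<open>Discreteness and parity\<close>

lemma less_succ_iff: "a \<prec> b \<oplus> \<one> \<longleftrightarrow> a \<preceq> b"
  by (auto simp: less_iff le_iff add_cancel simp flip: add_assoc)

lemma less_iff_succ_le: "a \<prec> b \<longleftrightarrow> a \<oplus> \<one> \<preceq> b"
  using less_succ_iff[of "a \<oplus> \<one>" b] by simp

lemma not_less_zero: "\<not> a \<prec> \<zero>"
  by (metis less_iff add_succ succ_neq_zero)

lemma zero_le: "\<zero> \<preceq> a"
  using not_less_zero ar.not_less by blast

lemma pos_iff: "\<zero> \<prec> a \<longleftrightarrow> (\<exists>b. a = b \<oplus> \<one>)"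
  by (auto simp: less_iff zero_add)

lemma double_inject: "a \<oplus> a = b \<oplus> b \<longleftrightarrow> a = b"
  by (metis ar.add_strict_mono ar.less_irrefl ar.neq_iff)

text \<open>Equality would force \<open>a \<prec> b\<close>, hence
  \<open>a \<oplus> \<one> \<preceq> b\<close>; doubling this already exceeds the left side.\<close>

lemma double_succ_neq_double: "a \<oplus> a \<oplus> \<one> \<noteq> b \<oplus> b"
proof
  assume eq: "a \<oplus> a \<oplus> \<one> = b \<oplus> b"
  have "a \<prec> b"
  proof (rule ccontr)
    assume "\<not> a \<prec> b"
    then have "b \<oplus> b \<preceq> a \<oplus> a"
      by (simp add: ar.not_less ar.add_mono)
    moreover have "a \<oplus> a \<prec> a \<oplus> a \<oplus> \<one>"
      by (simp add: less_succ_iff)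
    ultimately show False
      unfolding eq by order
  qed
  then have "a \<oplus> \<one> \<preceq> b"
    by (simp add: less_iff_succ_le)
  then have "(a \<oplus> \<one>) \<oplus> (a \<oplus> \<one>) \<preceq> a \<oplus> a \<oplus> \<one>"
    using ar.add_mono eq by metis
  then show False
    using less_iff_succ_le[of "a \<oplus> a \<oplus> \<one>" "a \<oplus> a \<oplus> \<one>"] by (simp add: ac_simps)
qed

text \<open>One of two consecutive numbers is even, so the floor in the pairing function is exact.
  In the induction, the half grows by \<open>s \<oplus> \<one>\<close> from \<open>s\<close> to its
  successor.\<close>

lemma triangle_ex: "\<exists>q. q \<oplus> q = (s \<oplus> \<one>) \<otimes> s"
proof (rule induct_fm[where P = "\<lambda>s. \<exists>q. q \<oplus> q = (s \<oplus> \<one>) \<otimes> s" and x = 0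
      and f = "Ex 1 (Eq (Add (Var 1) (Var 1)) (Mul (Add (Var 0) One) (Var 0)))"])
  fix s assume "\<exists>q. q \<oplus> q = (s \<oplus> \<one>) \<otimes> s"
  then obtain q where "q \<oplus> q = (s \<oplus> \<one>) \<otimes> s" ..
  then have "(q \<oplus> q) \<oplus> ((s \<oplus> \<one>) \<oplus> (s \<oplus> \<one>)) = (s \<oplus> \<one> \<oplus> \<one>) \<otimes> (s \<oplus> \<one>)"
    by (simp add: algebra_simps)
  then have "(q \<oplus> (s \<oplus> \<one>)) \<oplus> (q \<oplus> (s \<oplus> \<one>)) = (s \<oplus> \<one> \<oplus> \<one>) \<otimes> (s \<oplus> \<one>)"
    by (simp only: ac_simps)
  then show "\<exists>q. q \<oplus> q = (s \<oplus> \<one> \<oplus> \<one>) \<otimes> (s \<oplus> \<one>)" ..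
qed (auto intro: exI[of _ \<zero>])

section \<open>Pairing and the beta function\<close>

definition pair_rel :: "'a \<Rightarrow> 'a \<Rightarrow> 'a \<Rightarrow> bool" where
  "pair_rel x y z \<longleftrightarrow>
     (\<exists>q. (q \<oplus> q = (x \<oplus> y \<oplus> \<one>) \<otimes> (x \<oplus> y) \<or> q \<oplus> q \<oplus> \<one> = (x \<oplus> y \<oplus> \<one>) \<otimes> (x \<oplus> y)) \<and>
          z = q \<oplus> y)"

lemma pair_rel_iff:
  "pair_rel x y z \<longleftrightarrow> (\<exists>q. q \<oplus> q = (x \<oplus> y \<oplus> \<one>) \<otimes> (x \<oplus> y) \<and> z = q \<oplus> y)"
  unfolding pair_rel_def using triangle_ex[of "x \<oplus> y"] double_succ_neq_double by metis

lemma pair_rel_ex: "\<exists>z. pair_rel x y z"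
  using triangle_ex[of "x \<oplus> y"] by (auto simp: pair_rel_iff)

lemma pair_rel_unique: "pair_rel x y z \<Longrightarrow> pair_rel x y z' \<Longrightarrow> z = z'"
  unfolding pair_rel_iff using double_inject by metis

text \<open>Pairs are enumerated diagonal by diagonal, where a diagonal has constant sum. All codes
  on one diagonal lie below the first code of the next.\<close>

lemma pair_rel_less:
  assumes "x \<oplus> y \<prec> x' \<oplus> y'" and "pair_rel x y z" and "pair_rel x' y' z'"
  shows "z \<prec> z'"
proof -
  obtain q q' where q: "q \<oplus> q = (x \<oplus> y \<oplus> \<one>) \<otimes> (x \<oplus> y)" "z = q \<oplus> y"
    and q': "q' \<oplus> q' = (x' \<oplus> y' \<oplus> \<one>) \<otimes> (x' \<oplus> y')" "z' = q' \<oplus> y'"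
    using assms by (auto simp: pair_rel_iff)
  \<comment> \<open>\<open>p\<close> is the triangular number that starts the diagonal with sum
    \<open>x \<oplus> y \<oplus> \<one>\<close>.\<close>
  define p where "p = q \<oplus> (x \<oplus> y \<oplus> \<one>)"
  have "x \<oplus> y \<oplus> \<one> \<preceq> x' \<oplus> y'"
    using assms(1) by (simp add: less_iff_succ_le)
  then have "(x \<oplus> y \<oplus> \<one> \<oplus> \<one>) \<otimes> (x \<oplus> y \<oplus> \<one>) \<preceq> (x' \<oplus> y' \<oplus> \<one>) \<otimes> (x' \<oplus> y')"
    by (intro ar.mult_mono ar.add_right_mono zero_le)
  moreover have "(x \<oplus> y \<oplus> \<one> \<oplus> \<one>) \<otimes> (x \<oplus> y \<oplus> \<one>) =
      (x \<oplus> y \<oplus> \<one>) \<otimes> (x \<oplus> y) \<oplus> (x \<oplus> y \<oplus> \<one>) \<oplus> (x \<oplus> y \<oplus> \<one>)"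
    by (simp add: algebra_simps)
  moreover have "\<dots> = p \<oplus> p"
    unfolding q(1)[symmetric] p_def by (simp only: ar.add.assoc ar.add.commute ar.add.left_commute)
  ultimately have "p \<oplus> p \<preceq> q' \<oplus> q'"
    by (simp only: q'(1))
  then have "p \<preceq> q'"
    by (metis ar.add_strict_mono ar.not_less)
  moreover have "z \<prec> p"
    unfolding less_iff q(2) p_def by (rule exI[of _ x]) (simp add: algebra_simps)
  moreover have "q' \<preceq> z'"
    using q'(2) zero_le[of y'] by auto
  ultimately show ?thesis
    by order
qed

text \<open>By \<open>pair_rel_less\<close> in both directions, equal codes lie on the same
  diagonal, where the code determines the second component.\<close>

lemma pair_rel_inject:
  assumes "pair_rel x y z" and "pair_rel x' y' z"
  shows "x = x' \<and> y = y'"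
proof -
  have eq: "x \<oplus> y = x' \<oplus> y'"
    using pair_rel_less assms by (metis ar.less_irrefl ar.neq_iff)
  with assms have "y = y'"
    unfolding pair_rel_iff using double_inject add_left_cancel by metis
  with eq show ?thesis
    by (simp add: add_cancel)
qed

section \<open>Division with remainder\<close>

definition rem_rel :: "'a \<Rightarrow> 'a \<Rightarrow> 'a \<Rightarrow> bool" where
  "rem_rel a m r \<longleftrightarrow> (\<exists>q. a = q \<otimes> m \<oplus> r) \<and> r \<prec> m"

lemma rem_rel_unique:
  assumes "rem_rel a m r" and "rem_rel a m r'"
  shows "r = r'"
proof -
  \<comment> \<open>A smaller quotient leaves the number below the next multiple of
    \<open>m\<close>, so two representations of the same number share their quotient.\<close>
  have less: "q \<otimes> m \<oplus> r \<prec> q' \<otimes> m \<oplus> r'" if "q \<prec> q'" "r \<prec> m" for q q' r r'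
  proof -
    have "(q \<oplus> \<one>) \<otimes> m \<preceq> q' \<otimes> m"
      using that(1) by (intro ar.mult_right_mono zero_le) (simp add: less_iff_succ_le)
    moreover have "q \<otimes> m \<oplus> r \<prec> (q \<oplus> \<one>) \<otimes> m"
      using that(2) by (simp add: algebra_simps)
    moreover have "q' \<otimes> m \<preceq> q' \<otimes> m \<oplus> r'"
      using zero_le by simp
    ultimately show ?thesis by order
  qed
  from assms obtain q q' where "a = q \<otimes> m \<oplus> r" "a = q' \<otimes> m \<oplus> r'" "r \<prec> m" "r' \<prec> m"
    unfolding rem_rel_def by blast
  with less[of q q' r r'] less[of q' q r' r] show ?thesis
    by (metis add_left_cancel ar.less_irrefl ar.neq_iff)
qed

text \<open>Induction on \<open>a\<close>: the remainder grows by one until it would reach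
  \<open>m\<close>; then it drops to zero and the quotient grows. Variable 3 of the formula stands
  for \<open>m\<close>.\<close>

lemma rem_rel_ex:
  assumes "\<zero> \<prec> m"
  shows "\<exists>r. rem_rel a m r"
proof (rule induct_fm[where P = "\<lambda>a. \<exists>r. rem_rel a m r" and v = "\<lambda>_. m" and x = 0
      and f = "Ex 1 (And (Ex 2 (Eq (Var 0) (Add (Mul (Var 2) (Var 3)) (Var 1)))) (Less (Var 1) (Var 3)))"])
  fix a assume "\<exists>r. rem_rel a m r"
  then obtain q r where a: "a = q \<otimes> m \<oplus> r" "r \<prec> m"
    by (auto simp: rem_rel_def)
  show "\<exists>r. rem_rel (a \<oplus> \<one>) m r"
  proof (cases "r \<oplus> \<one> = m")
    case True
    have "a \<oplus> \<one> = q \<otimes> m \<oplus> (r \<oplus> \<one>)"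
      using a by (simp add: ar.add.assoc)
    with True have "a \<oplus> \<one> = (q \<oplus> \<one>) \<otimes> m \<oplus> \<zero>"
      by (simp add: ar.distrib_right)
    with assms show ?thesis
      unfolding rem_rel_def by blast
  next
    case False
    with a have "a \<oplus> \<one> = q \<otimes> m \<oplus> (r \<oplus> \<one>)" "r \<oplus> \<one> \<prec> m"
      by (auto simp: less_iff_succ_le[of r] algebra_simps ar.le_less)
    then show ?thesis
      unfolding rem_rel_def by blast
  qed
qed (use assms in \<open>auto simp: rem_rel_def intro!: exI[of _ \<zero>]\<close>)

lemma rem_rel_add: "rem_rel a m r \<Longrightarrow> rem_rel (a \<oplus> q \<otimes> m) m r"
proof -
  assume "rem_rel a m r"
  then obtain p where "a = p \<otimes> m \<oplus> r" "r \<prec> m" by (auto simp: rem_rel_def)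
  then have "a \<oplus> q \<otimes> m = (p \<oplus> q) \<otimes> m \<oplus> r" "r \<prec> m"
    by (auto simp: algebra_simps)
  then show ?thesis unfolding rem_rel_def by blast
qed

lemma rem_rel_self: "r \<prec> m \<Longrightarrow> rem_rel r m r"
  by (auto simp: rem_rel_def intro!: exI[of _ \<zero>])

lemma rem_rel_le: "rem_rel a m r \<Longrightarrow> r \<preceq> a"
  by (auto simp: rem_rel_def zero_le)

section \<open>Invertible residues\<close>

definition unit_mod :: "'a \<Rightarrow> 'a \<Rightarrow> bool" where
  "unit_mod a m \<longleftrightarrow> (\<exists>x y. a \<otimes> x = m \<otimes> y \<oplus> \<one>)"

lemma unit_mod_one: "unit_mod \<one> m"
  unfolding unit_mod_def by (intro exI[of _ \<one>] exI[of _ \<zero>]) simp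

lemma unit_mod_mult:
  assumes "unit_mod a m" and "unit_mod b m"
  shows "unit_mod (a \<otimes> b) m"
proof -
  obtain x y x' y' where x: "a \<otimes> x = m \<otimes> y \<oplus> \<one>" and x': "b \<otimes> x' = m \<otimes> y' \<oplus> \<one>"
    using assms by (auto simp: unit_mod_def)
  have "a \<otimes> b \<otimes> (x \<otimes> x') = (a \<otimes> x) \<otimes> (b \<otimes> x')"
    by (simp add: algebra_simps)
  \<comment> \<open>Expands \<open>(m \<otimes> y \<oplus> \<one>) \<otimes> (m \<otimes> y'
    \<oplus> \<one>)\<close> and collects the multiples of \<open>m\<close>.\<close>
  also have "\<dots> = m \<otimes> (y \<otimes> m \<otimes> y' \<oplus> y \<oplus> y') \<oplus> \<one>"
    unfolding x x' by (simp add: algebra_simps)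
  finally show ?thesis unfolding unit_mod_def by blast
qed

text \<open>The first hypothesis makes \<open>a \<otimes> x\<close> equal to -1 modulo
  \<open>m\<close>. As \<open>n\<close> is -1 too, \<open>x \<otimes> n\<close> is an inverse of
  \<open>a\<close>.\<close>

lemma unit_mod_neg:
  assumes "a \<otimes> x \<oplus> \<one> = m \<otimes> y" and m: "m = n \<oplus> \<one>" and "n \<noteq> \<zero>"
  shows "unit_mod a m"
proof -
  \<comment> \<open>Replaces a subtraction: \<open>y \<otimes> n\<close> must be positive so that
    one copy of \<open>m\<close> can be split off and cancelled.\<close>
  have "y \<noteq> \<zero>"
    using assms(1) succ_neq_zero by auto
  with \<open>n \<noteq> \<zero>\<close> have "y \<otimes> n \<noteq> \<zero>"
    by simp
  then obtain z where z: "y \<otimes> n = z \<oplus> \<one>"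
    using zero_or_succ by blast
  have "a \<otimes> (x \<otimes> n) \<oplus> m = (a \<otimes> x \<oplus> \<one>) \<otimes> n \<oplus> \<one>"
    unfolding m by (simp add: algebra_simps)
  also have "\<dots> = m \<otimes> (y \<otimes> n) \<oplus> \<one>"
    unfolding assms(1) by (simp add: algebra_simps)
  also have "\<dots> = (m \<otimes> z \<oplus> \<one>) \<oplus> m"
    unfolding z by (simp add: algebra_simps)
  finally have "a \<otimes> (x \<otimes> n) = m \<otimes> z \<oplus> \<one>"
    by (simp only: add_cancel)
  then show ?thesis unfolding unit_mod_def by blast
qed

text \<open>The multiples of an invertible \<open>b\<close> reach every residue class modulo
  \<open>m\<close>; this is one step of Chinese remaindering.\<close>

lemma crt_step:
  assumes "unit_mod b m" and "r \<prec> m"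
  shows "\<exists>z. rem_rel (a \<oplus> b \<otimes> z) m r"
proof -
  obtain x y where x: "b \<otimes> x = m \<otimes> y \<oplus> \<one>"
    using assms(1) by (auto simp: unit_mod_def)
  obtain n where m: "m = n \<oplus> \<one>"
    using assms(2) zero_or_succ not_less_zero by metis
  \<comment> \<open>As \<open>x\<close> inverts \<open>b\<close> and \<open>n\<close> is -1 modulo
    \<open>m\<close>, the factor \<open>x \<otimes> (r \<oplus> a \<otimes> n)\<close> stands for
    \<open>r - a\<close> divided by \<open>b\<close>.\<close>
  have "a \<oplus> b \<otimes> (x \<otimes> (r \<oplus> a \<otimes> n)) = a \<oplus> (b \<otimes> x) \<otimes> (r \<oplus> a \<otimes> n)"
    by (simp add: algebra_simps)
  also have "\<dots> = m \<otimes> y \<otimes> (r \<oplus> a \<otimes> n) \<oplus> a \<otimes> (n \<oplus> \<one>) \<oplus> r"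
    unfolding x by (simp add: algebra_simps)
  also have "\<dots> = (y \<otimes> (r \<oplus> a \<otimes> n) \<oplus> a) \<otimes> m \<oplus> r"
    unfolding m[symmetric] by (simp add: algebra_simps)
  finally show ?thesis
    using assms(2) unfolding rem_rel_def by blast
qed

text \<open>Takes the place of a factorial: the induction step multiplies by
  \<open>k \<oplus> \<one> \<oplus> \<one>\<close>, and only the existence of a common multiple is
  carried along.\<close>

lemma common_multiple_ex: "\<exists>e. \<zero> \<prec> e \<and> (\<forall>j. j \<preceq> k \<longrightarrow> (\<exists>q. e = (j \<oplus> \<one>) \<otimes> q))"
proof (rule induct_fm[where P = "\<lambda>k. \<exists>e. \<zero> \<prec> e \<and> (\<forall>j. j \<preceq> k \<longrightarrow> (\<exists>q. e = (j \<oplus> \<one>) \<otimes> q))" and x = 0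
      and f = "Ex 1 (And (Less Zero (Var 1)) (All 2 (Imp (Or (Less (Var 2) (Var 0)) (Eq (Var 2) (Var 0)))
          (Ex 3 (Eq (Var 1) (Mul (Add (Var 2) One) (Var 3)))))))"])
  show "\<exists>e. \<zero> \<prec> e \<and> (\<forall>j. j \<preceq> \<zero> \<longrightarrow> (\<exists>q. e = (j \<oplus> \<one>) \<otimes> q))"
    by (rule exI[of _ \<one>]) (auto simp: le_of_def not_less_zero)
next
  fix k assume "\<exists>e. \<zero> \<prec> e \<and> (\<forall>j. j \<preceq> k \<longrightarrow> (\<exists>q. e = (j \<oplus> \<one>) \<otimes> q))"
  then obtain e where e: "\<zero> \<prec> e" "\<And>j. j \<preceq> k \<Longrightarrow> \<exists>q. e = (j \<oplus> \<one>) \<otimes> q" by blast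
  have "\<exists>q. e \<otimes> (k \<oplus> \<one> \<oplus> \<one>) = (j \<oplus> \<one>) \<otimes> q" if "j \<preceq> k \<oplus> \<one>" for j
  proof (cases "j = k \<oplus> \<one>")
    case True
    then show ?thesis by (metis ar.mult.commute)
  next
    case False
    with that have "j \<preceq> k" by (simp add: ar.le_less less_succ_iff)
    with e(2) show ?thesis by (metis ar.mult.assoc)
  qed
  moreover have "\<zero> \<prec> e \<otimes> (k \<oplus> \<one> \<oplus> \<one>)"
    using e(1) pos_iff ar.mult_pos_pos by blast
  ultimately show "\<exists>e. \<zero> \<prec> e \<and> (\<forall>j. j \<preceq> k \<oplus> \<one> \<longrightarrow> (\<exists>q. e = (j \<oplus> \<one>) \<otimes> q))" by blast
qed (auto simp: le_of_def)

section \<open>Moduli of the beta function\<close>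

definition modulus :: "'a \<Rightarrow> 'a \<Rightarrow> 'a" where
  "modulus d j = d \<otimes> (j \<oplus> \<one>) \<oplus> \<one>"

lemma less_modulus: "a \<prec> d \<Longrightarrow> a \<prec> modulus d j"
  unfolding modulus_def less_succ_iff using zero_le[of "d \<otimes> j"]
  by (auto simp: algebra_simps intro: ar.add_increasing2 ar.less_imp_le)

lemma modulus_pos: "\<zero> \<prec> modulus d j"
  by (auto simp: modulus_def pos_iff)

text \<open>With \<open>m\<^sub>j = modulus d j\<close>, the number \<open>m\<^sub>j (i + 1) - m\<^sub>i (j + 1)\<close> is \<open>i - j\<close>, a divisor of \<open>d\<close>, and
  \<open>d (i + 1) = m\<^sub>i - 1\<close>; so \<open>m\<^sub>j (i + 1)\<^sup>2 t\<close> is \<open>-1\<close> modulo \<open>m\<^sub>i\<close>.\<close>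

lemma unit_mod_modulus:
  assumes d: "d = (g \<oplus> \<one>) \<otimes> t" "\<zero> \<prec> d" and i: "i = j \<oplus> (g \<oplus> \<one>)"
  shows "unit_mod (modulus d j) (modulus d i)"
proof (rule unit_mod_neg)
  have "modulus d j \<otimes> (i \<oplus> \<one>) = modulus d i \<otimes> (j \<oplus> \<one>) \<oplus> (g \<oplus> \<one>)"
    unfolding modulus_def i by (simp add: algebra_simps)
  then have eq: "modulus d j \<otimes> (i \<oplus> \<one>) \<otimes> (t \<otimes> (i \<oplus> \<one>)) =
      (modulus d i \<otimes> (j \<oplus> \<one>) \<oplus> (g \<oplus> \<one>)) \<otimes> (t \<otimes> (i \<oplus> \<one>))"
    by (rule arg_cong)
  have "modulus d j \<otimes> ((i \<oplus> \<one>) \<otimes> (t \<otimes> (i \<oplus> \<one>))) \<oplus> \<one> =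
      (modulus d i \<otimes> (j \<oplus> \<one>) \<oplus> (g \<oplus> \<one>)) \<otimes> (t \<otimes> (i \<oplus> \<one>)) \<oplus> \<one>"
    unfolding eq[symmetric] by (simp only: ar.mult.assoc)
  also have "\<dots> = modulus d i \<otimes> ((j \<oplus> \<one>) \<otimes> (t \<otimes> (i \<oplus> \<one>))) \<oplus> ((g \<oplus> \<one>) \<otimes> t \<otimes> (i \<oplus> \<one>) \<oplus> \<one>)"
    by (simp only: ar.mult.assoc ar.distrib_right ar.add.assoc)
  also have "\<dots> = modulus d i \<otimes> ((j \<oplus> \<one>) \<otimes> (t \<otimes> (i \<oplus> \<one>))) \<oplus> modulus d i"
    by (simp only: d(1)[symmetric] modulus_def[of d i])
  also have "\<dots> = modulus d i \<otimes> ((j \<oplus> \<one>) \<otimes> (t \<otimes> (i \<oplus> \<one>)) \<oplus> \<one>)"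
    by (simp only: ar.distrib_left ar.mult_1_right)
  finally show "modulus d j \<otimes> ((i \<oplus> \<one>) \<otimes> (t \<otimes> (i \<oplus> \<one>))) \<oplus> \<one> =
      modulus d i \<otimes> ((j \<oplus> \<one>) \<otimes> (t \<otimes> (i \<oplus> \<one>)) \<oplus> \<one>)" .
  show "modulus d i = d \<otimes> (i \<oplus> \<one>) \<oplus> \<one>"
    by (rule modulus_def)
  show "d \<otimes> (i \<oplus> \<one>) \<noteq> \<zero>"
    using d(2) succ_neq_zero by auto
qed

section \<open>Goedel's lemma on the beta function\<close>

definition beta_rel :: "'a \<Rightarrow> 'a \<Rightarrow> 'a \<Rightarrow> bool" where
  "beta_rel w j r \<longleftrightarrow> (\<exists>l d. pair_rel l d w \<and> rem_rel l (modulus d j) r)"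

lemma beta_rel_unique: "beta_rel w j r \<Longrightarrow> beta_rel w j r' \<Longrightarrow> r = r'"
  unfolding beta_rel_def by (metis pair_rel_inject rem_rel_unique)

text \<open>A number below the modulus is its own remainder, so the pair of \<open>c\<close> and
  \<open>c \<oplus> \<one>\<close> is a suitable code.\<close>

lemma beta_rel_singleton: "\<exists>w. beta_rel w \<zero> c"
proof -
  obtain w where "pair_rel c (c \<oplus> \<one>) w"
    using pair_rel_ex by blast
  moreover have "c \<prec> modulus (c \<oplus> \<one>) \<zero>"
    by (rule less_modulus) (simp add: less_succ_iff)
  ultimately show ?thesis
    unfolding beta_rel_def using rem_rel_self by blast
qed

text \<open>The new moduli need a larger \<open>d'\<close>, so all old entries have to be coded again. Products of
  nonstandard length are not available; the induction on \<open>s\<close> therefore carries, next to the number \<open>a\<close>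
  with the first \<open>s\<close> residues, a common multiple \<open>b\<close> of the first \<open>s\<close> moduli that is invertible modulo
  the remaining ones.\<close>

lemma beta_rel_extend:
  assumes "beta_rel w i r0"
  shows "\<exists>w'. (\<forall>j r. j \<preceq> k \<longrightarrow> beta_rel w j r \<longrightarrow> beta_rel w' j r) \<and> beta_rel w' (k \<oplus> \<one>) c"
proof -
  obtain l d where w: "pair_rel l d w"
    using assms by (auto simp: beta_rel_def)
  obtain e where e: "\<zero> \<prec> e" "\<And>j. j \<preceq> k \<Longrightarrow> \<exists>q. e = (j \<oplus> \<one>) \<otimes> q"
    using common_multiple_ex by blast
  \<comment> \<open>The factor \<open>e\<close> is divisible by all differences of distinct indices
    up to \<open>k \<oplus> \<one>\<close>, as \<open>unit_mod_modulus\<close> requires. The factor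
    \<open>l \<oplus> c \<oplus> \<one>\<close> makes \<open>d'\<close> exceed \<open>c\<close> and
    every old remainder, which is at most \<open>l\<close>.\<close>
  define d' where "d' = e \<otimes> (l \<oplus> c \<oplus> \<one>)"
  have "\<one> \<otimes> (l \<oplus> c \<oplus> \<one>) \<preceq> d'"
    unfolding d'_def using e(1) by (intro ar.mult_right_mono zero_le) (simp add: less_iff_succ_le)
  then have lc: "l \<oplus> c \<prec> d'"
    by (simp add: less_iff_succ_le)
  then have l: "l \<prec> d'" and c: "c \<prec> d'" and d'_pos: "\<zero> \<prec> d'"
    by (metis ar.le_less_trans le_iff ar.add.commute zero_le)+
  have unit: "unit_mod (modulus d' j) (modulus d' i)" if "j \<prec> i" "i \<preceq> k \<oplus> \<one>" for i j
  proof -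
    from that(1) obtain g where i: "i = j \<oplus> (g \<oplus> \<one>)"
      by (auto simp: less_iff)
    then have "g \<oplus> \<one> \<preceq> i"
      using zero_le by simp
    with that(2) have "g \<oplus> \<one> \<preceq> k \<oplus> \<one>"
      by order
    then have "g \<preceq> k"
      by simp
    with e(2) obtain q where "e = (g \<oplus> \<one>) \<otimes> q" by blast
    then have "d' = (g \<oplus> \<one>) \<otimes> (q \<otimes> (l \<oplus> c \<oplus> \<one>))"
      by (simp only: d'_def ar.mult.assoc)
    from unit_mod_modulus[OF this d'_pos i] show ?thesis .
  qed
  define P where "P s \<longleftrightarrow> (s \<preceq> k \<oplus> \<one> \<longrightarrow> (\<exists>a b.
      (\<forall>j. j \<prec> s \<longrightarrow> (\<exists>r. rem_rel a (modulus d' j) r \<and> rem_rel l (modulus d j) r)) \<and>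
      (\<forall>j. j \<prec> s \<longrightarrow> (\<exists>q. b = q \<otimes> modulus d' j)) \<and>
      (\<forall>i. s \<preceq> i \<and> i \<preceq> k \<oplus> \<one> \<longrightarrow> unit_mod b (modulus d' i))))" for s
  \<comment> \<open>The invariant as a formula: variables 0 to 4 hold \<open>s\<close>,
    \<open>k\<close>, \<open>l\<close>, \<open>d\<close>, \<open>d'\<close>, where \<open>d'\<close>
    is the default value; variables 5 and 6 are \<open>a\<close> and \<open>b\<close>.\<close>
  let ?le = "\<lambda>s t. Or (Less s t) (Eq s t)" and ?k = "Add (Var 1) One"
  let ?rem = "\<lambda>a m r. And (Ex 9 (Eq a (Add (Mul (Var 9) m) r))) (Less r m)"
  let ?mod = "\<lambda>d. Add (Mul d (Add (Var 7) One)) One"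
  let ?f = "Imp (?le (Var 0) ?k) (Ex 5 (Ex 6 (And
      (All 7 (Imp (Less (Var 7) (Var 0))
        (Ex 8 (And (?rem (Var 5) (?mod (Var 4)) (Var 8)) (?rem (Var 2) (?mod (Var 3)) (Var 8))))))
      (And (All 7 (Imp (Less (Var 7) (Var 0)) (Ex 9 (Eq (Var 6) (Mul (Var 9) (?mod (Var 4)))))))
        (All 7 (Imp (And (?le (Var 0) (Var 7)) (?le (Var 7) ?k))
          (Ex 8 (Ex 9 (Eq (Mul (Var 6) (Var 8)) (Add (Mul (?mod (Var 4)) (Var 9)) One))))))))))"
  have "P (k \<oplus> \<one>)"
  proof (rule induct_fm[where P = P and x = 0 and f = ?f and v = "(\<lambda>_. d')(1 := k, 2 := l, 3 := d)"])
    show "P s \<longleftrightarrow> sat M ((\<lambda>_. d')(1 := k, 2 := l, 3 := d, 0 := s)) ?f" for s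
      by (simp add: P_def le_of_def rem_rel_def unit_mod_def modulus_def)
    show "P \<zero>"
      unfolding P_def using unit_mod_one not_less_zero by metis
  next
    fix s assume "P s"
    show "P (s \<oplus> \<one>)"
      unfolding P_def
    proof
      assume sk: "s \<oplus> \<one> \<preceq> k \<oplus> \<one>"
      then have "s \<prec> k \<oplus> \<one>"
        by (simp only: less_iff_succ_le)
      then have "s \<preceq> k \<oplus> \<one>"
        by order
      with \<open>P s\<close> obtain a b where
        a: "\<And>j. j \<prec> s \<Longrightarrow> \<exists>r. rem_rel a (modulus d' j) r \<and> rem_rel l (modulus d j) r" and
        b: "\<And>j. j \<prec> s \<Longrightarrow> \<exists>q. b = q \<otimes> modulus d' j" and
        u: "\<And>i. s \<preceq> i \<Longrightarrow> i \<preceq> k \<oplus> \<one> \<Longrightarrow> unit_mod b (modulus d' i)"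
        unfolding P_def by blast
      obtain r where r: "rem_rel l (modulus d s) r"
        using rem_rel_ex modulus_pos by blast
      then have "r \<prec> modulus d' s"
        using rem_rel_le l less_modulus ar.le_less_trans by blast
      then obtain z where z: "rem_rel (a \<oplus> b \<otimes> z) (modulus d' s) r"
        using crt_step u \<open>s \<prec> k \<oplus> \<one>\<close> ar.less_imp_le ar.order.refl by metis
      show "\<exists>a b.
          (\<forall>j. j \<prec> s \<oplus> \<one> \<longrightarrow> (\<exists>r. rem_rel a (modulus d' j) r \<and> rem_rel l (modulus d j) r)) \<and>
          (\<forall>j. j \<prec> s \<oplus> \<one> \<longrightarrow> (\<exists>q. b = q \<otimes> modulus d' j)) \<and>
          (\<forall>i. s \<oplus> \<one> \<preceq> i \<and> i \<preceq> k \<oplus> \<one> \<longrightarrow> unit_mod b (modulus d' i))"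
      \<comment> \<open>Adding a multiple of \<open>b\<close> preserves the first \<open>s\<close>
        residues, because \<open>b\<close> is a multiple of their moduli; the modulus at
        \<open>s\<close> is then multiplied into \<open>b\<close>.\<close>
      proof (rule exI[of _ "a \<oplus> b \<otimes> z"], rule exI[of _ "b \<otimes> modulus d' s"], intro conjI allI impI)
        fix j assume "j \<prec> s \<oplus> \<one>"
        then have j: "j \<prec> s \<or> j = s"
          by (simp add: less_succ_iff ar.le_less)
        show "\<exists>r. rem_rel (a \<oplus> b \<otimes> z) (modulus d' j) r \<and> rem_rel l (modulus d j) r"
        proof (cases "j = s")
          case False
          with j have "j \<prec> s" by blast
          with a b obtain r q where "rem_rel a (modulus d' j) r" "rem_rel l (modulus d j) r"
            "b = q \<otimes> modulus d' j" by metis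
          then show ?thesis
            using rem_rel_add[of a "modulus d' j" r "q \<otimes> z"] by (auto simp: ac_simps)
        qed (use r z in auto)
        show "\<exists>q. b \<otimes> modulus d' s = q \<otimes> modulus d' j"
          using j b by (metis ar.mult.commute ar.mult.left_commute)
      next
        fix i assume "s \<oplus> \<one> \<preceq> i \<and> i \<preceq> k \<oplus> \<one>"
        then have "s \<prec> i" "i \<preceq> k \<oplus> \<one>" by (auto simp: less_iff_succ_le)
        then show "unit_mod (b \<otimes> modulus d' s) (modulus d' i)"
          using unit u unit_mod_mult ar.less_imp_le by blast
      qed
    qed
  qed
  then obtain a b where
    a: "\<And>j. j \<prec> k \<oplus> \<one> \<Longrightarrow> \<exists>r. rem_rel a (modulus d' j) r \<and> rem_rel l (modulus d j) r" and
    b: "\<And>j. j \<prec> k \<oplus> \<one> \<Longrightarrow> \<exists>q. b = q \<otimes> modulus d' j" and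
    u: "unit_mod b (modulus d' (k \<oplus> \<one>))"
    unfolding P_def using ar.order.refl[of "k \<oplus> \<one>"] by blast
  \<comment> \<open>The new entry \<open>c\<close> is put in last, by one more remainder step at
    index \<open>k \<oplus> \<one>\<close>.\<close>
  obtain z where z: "rem_rel (a \<oplus> b \<otimes> z) (modulus d' (k \<oplus> \<one>)) c"
    using crt_step u c less_modulus by blast
  obtain w' where w': "pair_rel (a \<oplus> b \<otimes> z) d' w'"
    using pair_rel_ex by blast
  have "beta_rel w' j r" if "j \<preceq> k" "beta_rel w j r" for j r
  proof -
    have "rem_rel l (modulus d j) r"
      using that(2) w pair_rel_inject unfolding beta_rel_def by blast
    with a b that(1) obtain q where "rem_rel a (modulus d' j) r" "b = q \<otimes> modulus d' j"
      using rem_rel_unique less_succ_iff by metis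
    then have "rem_rel (a \<oplus> b \<otimes> z) (modulus d' j) r"
      using rem_rel_add[of a "modulus d' j" r "q \<otimes> z"] by (simp add: ac_simps)
    with w' show ?thesis unfolding beta_rel_def by blast
  qed
  with z w' show ?thesis unfolding beta_rel_def by blast
qed

end

section \<open>Meaning of the formulas\<close>

lemma less_fresh: "x \<in> set xs \<Longrightarrow> x < fresh xs"
proof -
  assume "x \<in> set xs"
  then have "x \<le> foldr max xs 0"
    by (induction xs) auto
  then show ?thesis
    by (simp add: fresh_def)
qed

lemma upd_Nil [simp]: "upd v [] as = v"
  by (simp add: upd_def fun_eq_iff)

lemma upd_Cons [simp]: "upd v (x # xs) (a # as) = (upd v xs as)(x := a)"
  by (simp add: upd_def fun_eq_iff)

lemma upd_notin: "x \<notin> set xs \<Longrightarrow> upd v xs as x = v x"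
  by (auto simp: upd_def split: option.split dest!: map_of_SomeD set_zip_leftD)

lemma upd_fun_upd: "x \<notin> set xs \<Longrightarrow> upd (v(x := a)) xs as = (upd v xs as)(x := a)"
  by (auto simp: fun_eq_iff upd_notin) (simp add: upd_def split: option.split)

lemma map_upd: "distinct xs \<Longrightarrow> length as = length xs \<Longrightarrow> map (upd v xs as) xs = as"
proof (induction xs arbitrary: as)
  case (Cons x xs)
  then show ?case by (cases as) (auto simp add: fun_upd_same simp del: fun_upd_apply)
qed simp

lemma map_upd_disjoint: "set ys \<inter> set xs = {} \<Longrightarrow> map (upd v xs as) ys = map v ys"
  by (auto intro!: upd_notin)

lemma upd_map [simp]: "upd v xs (map v xs) = v"
  by (induction xs) auto

lemma upd_agree: "x \<in> set xs \<Longrightarrow> length as = length xs \<Longrightarrow> upd v xs as x = upd v' xs as x"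
  by (simp add: upd_def split: option.split)

lemma eval_ren:
  "length us = length xs \<Longrightarrow> eval M v (ren xs us x) = upd v xs (map v us) x"
  by (auto simp: ren_def upd_def zip_map2 map_of_map split: option.split dest: map_of_SomeD set_zip_leftD)

lemma bsat_simps [simp]:
  "bsat M v (BLess s t) \<longleftrightarrow> less_of M (eval M v s) (eval M v t)"
  "bsat M v (BNot b) \<longleftrightarrow> \<not> bsat M v b"
  "bsat M v (BImp b c) \<longleftrightarrow> (bsat M v b \<longrightarrow> bsat M v c)"
  by (simp_all add: bsat_def eval_inst)

lemma sat_bexp_fm: "sat M v (bexp_fm \<sigma> b) \<longleftrightarrow> bsat M (\<lambda>x. eval M v (\<sigma> x)) b"
  by (induction b) (simp_all add: eval_inst)

lemma bsat_cong: "(\<And>x. x \<in> set (bexp_vars b) \<Longrightarrow> v x = v' x) \<Longrightarrow> bsat M v b \<longleftrightarrow> bsat M v' b"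
  by (induction b) (auto simp: eval_cong[of _ v v'])

lemma sat_conjs [simp]: "sat M v (conjs fs) \<longleftrightarrow> (\<forall>f\<in>set fs. sat M v f)"
  unfolding conjs_def by (induction fs) auto

lemma sat_exs:
  "distinct xs \<Longrightarrow> sat M v (exs xs f) \<longleftrightarrow> (\<exists>as. length as = length xs \<and> sat M (upd v xs as) f)"
proof (induction xs arbitrary: v)
  case (Cons x xs)
  then have "sat M v (exs (x # xs) f) \<longleftrightarrow>
      (\<exists>a as. length as = length xs \<and> sat M (upd v (x # xs) (a # as)) f)"
    by (simp add: exs_def upd_fun_upd)
  then show ?case
    by (simp only: length_Cons length_Suc_conv) blast
qed (simp add: exs_def)

context pa_model begin

section \<open>Relations defined by the coding formulas\<close>

lemma sat_pair_fm [simp]: "sat M v (pair_fm x y z) \<longleftrightarrow> pair_rel (v x) (v y) (v z)"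
proof -
  have "x < fresh [x, y, z]" "y < fresh [x, y, z]" "z < fresh [x, y, z]"
    by (simp_all add: less_fresh)
  then show ?thesis
    by (simp add: pair_fm_def Let_def pair_rel_def)
qed

text \<open>Every number codes the empty tuple, so codes are unique only for nonempty
  tuples.\<close>

fun tuple_rel :: "'a list \<Rightarrow> 'a \<Rightarrow> bool" where
  "tuple_rel [] c \<longleftrightarrow> True"
| "tuple_rel [a] c \<longleftrightarrow> a = c"
| "tuple_rel (a # as) c \<longleftrightarrow> (\<exists>r. pair_rel a r c \<and> tuple_rel as r)"

lemma tuple_rel_ex: "\<exists>c. tuple_rel as c"
  by (induction as rule: induct_list012) (auto, metis pair_rel_ex)

lemma tuple_rel_unique: "as \<noteq> [] \<Longrightarrow> tuple_rel as c \<Longrightarrow> tuple_rel as c' \<Longrightarrow> c = c'"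
  by (induction as arbitrary: c c' rule: induct_list012) (auto, metis pair_rel_unique)

lemma tuple_rel_inject: "length as = length bs \<Longrightarrow> tuple_rel as c \<Longrightarrow> tuple_rel bs c \<Longrightarrow> as = bs"
proof (induction as c arbitrary: bs rule: tuple_rel.induct)
  case (3 a a' as c)
  then obtain b b' bs' where bs: "bs = b # b' # bs'" "length as = length bs'"
    by (metis length_Suc_conv)
  with 3 show ?case
    by simp (metis pair_rel_inject length_Cons list.inject)
qed (auto simp: Suc_length_conv)

lemma sat_tuple_fm [simp]: "sat M v (tuple_fm us z) \<longleftrightarrow> tuple_rel (map v us) (v z)"
proof (induction us z arbitrary: v rule: tuple_fm.induct)
  case (3 u u' us z)
  define r where "r = fresh (z # u # u' # us)"
  have "z < r" "u < r" and us: "x \<in> set (u' # us) \<Longrightarrow> x < r" for x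
    by (auto simp: r_def intro!: less_fresh)
  have "map (v(r := a)) (u' # us) = map v (u' # us)" for a
    using us by auto
  with 3[OF r_def] \<open>z < r\<close> \<open>u < r\<close> show ?case
    by (simp only: tuple_fm.simps Let_def tuple_rel.simps list.map sat.simps sat_pair_fm flip: r_def)
      (simp add: fun_upd_def)
qed auto

lemma sat_beta_fm [simp]: "sat M v (beta_fm w t r) \<longleftrightarrow> beta_rel (v w) (eval M v t) (v r)"
proof -
  define l where "l = fresh (w # r # tm_vars t)"
  have l: "w < l" "r < l" and t: "x \<in> set (tm_vars t) \<Longrightarrow> x < l" for x
    by (auto simp: l_def intro!: less_fresh)
  have "eval M (v(l := a, Suc l := b, Suc (Suc l) := c)) t = eval M v t" for a b c
    using t by (intro eval_cong) fastforce
  with l show ?thesis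
    by (auto simp: beta_fm_def Let_def exs_def beta_rel_def rem_rel_def modulus_def simp flip: l_def)
qed

definition entry_rel :: "'a list \<Rightarrow> 'a \<Rightarrow> 'a \<Rightarrow> bool" where
  "entry_rel as w j \<longleftrightarrow> (\<exists>c. beta_rel w j c \<and> tuple_rel as c)"

lemma sat_entry_fm [simp]:
  "sat M v (entry_fm us w t) \<longleftrightarrow> entry_rel (map v us) (v w) (eval M v t)"
proof -
  define c where "c = fresh (w # tm_vars t @ us)"
  have c: "w < c" and us: "x \<in> set us \<Longrightarrow> x < c" and t: "x \<in> set (tm_vars t) \<Longrightarrow> x < c" for x
    by (auto simp: c_def intro!: less_fresh)
  have "eval M (v(c := a)) t = eval M v t" for a
    by (auto intro!: eval_cong dest: t)
  moreover have "c \<notin> set us"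
    using us by blast
  ultimately show ?thesis
    using c by (simp add: entry_fm_def entry_rel_def flip: c_def)
qed

text \<open>The code \<open>w\<close> is an argument, not quantified as in \<open>run_fm\<close>,
  because later a single code is cut at an earlier index and two codes are compared.\<close>

definition run_rel :: "('a list \<Rightarrow> 'a list \<Rightarrow> bool) \<Rightarrow> 'a \<Rightarrow> 'a \<Rightarrow> 'a list \<Rightarrow> 'a list \<Rightarrow> bool" where
  "run_rel step w i p q \<longleftrightarrow> entry_rel p w \<zero> \<and>
     (\<forall>j. j \<prec> i \<longrightarrow> (\<exists>a b. length a = length p \<and> length b = length p \<and>
        entry_rel a w j \<and> entry_rel b w (j \<oplus> \<one>) \<and> step a b)) \<and>
     entry_rel q w i"

text \<open>The hypothesis ranges over all assignments and variable lists of the right length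
  because the step formula is read at fresh variables introduced by \<open>run_fm\<close>.\<close>

lemma sat_run_fm:
  assumes step: "\<And>v as bs. length as = length us \<Longrightarrow> length bs = length us \<Longrightarrow>
      sat M v (f as bs) \<longleftrightarrow> step (map v as) (map v bs)"
  shows "sat M v (run_fm f i us ys) \<longleftrightarrow> (\<exists>w. run_rel step w (v i) (map v us) (map v ys))"
proof -
  define n where "n = length us"
  define w where "w = fresh (i # us @ ys)"
  define as where "as = [w + 2 ..< w + 2 + n]"
  define bs where "bs = [w + 2 + n ..< w + 2 + 2 * n]"
  have i: "i < w" and us: "x \<in> set us \<Longrightarrow> x < w" and ys: "x \<in> set ys \<Longrightarrow> x < w" for x
    by (auto simp: w_def intro!: less_fresh)
  have w: "w \<notin> set us" "w \<notin> set ys"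
    using us ys by blast+
  have len: "length as = n" "length bs = n" and dist: "distinct (as @ bs)"
    by (auto simp: as_def bs_def)
  \<comment> \<open>The quantifier block over \<open>as @ bs\<close> amounts to a choice of two
    vectors of length \<open>n\<close>: the list of its values is cut in the middle.\<close>
  have inner: "sat M v' (exs (as @ bs) (conjs [entry_fm as w (Var (w + 1)),
        entry_fm bs w (Add (Var (w + 1)) One), f as bs])) \<longleftrightarrow>
      (\<exists>a b. length a = n \<and> length b = n \<and> entry_rel a (v' w) (v' (w + 1)) \<and>
         entry_rel b (v' w) (v' (w + 1) \<oplus> \<one>) \<and> step a b)" for v'
  proof -
    have "sat M (upd v' (as @ bs) (a @ b)) (conjs [entry_fm as w (Var (w + 1)),
        entry_fm bs w (Add (Var (w + 1)) One), f as bs]) \<longleftrightarrow>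
      entry_rel a (v' w) (v' (w + 1)) \<and> entry_rel b (v' w) (v' (w + 1) \<oplus> \<one>) \<and> step a b"
      if ab: "length a = n" "length b = n" for a b
    proof -
      let ?v = "upd v' (as @ bs) (a @ b)"
      have "map ?v (as @ bs) = a @ b"
        using ab len dist by (intro map_upd) auto
      then have "map ?v as = a" "map ?v bs = b"
        using ab len by auto
      moreover have "?v w = v' w" "?v (w + 1) = v' (w + 1)"
        by (auto intro!: upd_notin simp: as_def bs_def)
      ultimately show ?thesis
        using len by (simp add: step n_def)
    qed
    moreover have "(\<exists>c. length c = length (as @ bs) \<and> Q c) \<longleftrightarrow>
        (\<exists>a b. length a = n \<and> length b = n \<and> Q (a @ b))" for Q :: "'a list \<Rightarrow> bool"
    proof
      assume "\<exists>c. length c = length (as @ bs) \<and> Q c"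
      then obtain c where "length c = n + n" "Q (take n c @ drop n c)"
        using len by auto
      moreover from this have "length (take n c) = n" "length (drop n c) = n"
        by simp_all
      ultimately show "\<exists>a b. length a = n \<and> length b = n \<and> Q (a @ b)"
        by blast
    next
      assume "\<exists>a b. length a = n \<and> length b = n \<and> Q (a @ b)"
      then show "\<exists>c. length c = length (as @ bs) \<and> Q c"
        using len by (metis length_append)
    qed
    ultimately show ?thesis
      using dist by (subst sat_exs) auto
  qed
  have "sat M v (run_fm f i us ys) \<longleftrightarrow> (\<exists>c. sat M (v(w := c)) (conjs [entry_fm us w Zero,
      All (w + 1) (Imp (Less (Var (w + 1)) (Var i)) (exs (as @ bs) (conjs [
        entry_fm as w (Var (w + 1)), entry_fm bs w (Add (Var (w + 1)) One), f as bs]))),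
      entry_fm ys w (Var i)]))"
    by (simp only: run_fm_def Let_def n_def[symmetric] w_def[symmetric] as_def bs_def sat.simps)
  also have "\<dots> \<longleftrightarrow> (\<exists>w. run_rel step w (v i) (map v us) (map v ys))"
    unfolding sat_conjs using i
    by (simp add: inner[unfolded Suc_eq_plus1[symmetric]] w run_rel_def n_def)
  finally show ?thesis .
qed

definition env :: "var list \<Rightarrow> 'a list \<Rightarrow> 'a assignment" where
  "env xs p = upd (\<lambda>_. \<zero>) xs p"

text \<open>Lets expressions and guards with variables in \<open>xs\<close> be evaluated from the
  vector \<open>p\<close> alone, whatever the assignment does outside \<open>xs\<close>.\<close>

lemma env_upd: "x \<in> set xs \<Longrightarrow> length p = length xs \<Longrightarrow> upd v xs p x = env xs p x"
  unfolding env_def by (rule upd_agree)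

lemma bsat_env:
  "set (bexp_vars b) \<subseteq> set xs \<Longrightarrow> length p = length xs \<Longrightarrow> bsat M (upd v xs p) b \<longleftrightarrow> bsat M (env xs p) b"
  by (intro bsat_cong env_upd) auto

lemma sat_bexp_ren:
  assumes "set (bexp_vars b) \<subseteq> set xs" and "length us = length xs"
  shows "sat M v (bexp_fm (ren xs us) b) \<longleftrightarrow> bsat M (env xs (map v us)) b"
  using assms by (simp add: sat_bexp_fm eval_ren bsat_env)

text \<open>The relation on value vectors that \<open>alpha\<close> defines. Being independent of
  the variables chosen for input and output, it lets determinism be proved without renaming.\<close>

primrec alpha_rel :: "var list \<Rightarrow> prog \<Rightarrow> 'a list \<Rightarrow> 'a list \<Rightarrow> bool" where
  "alpha_rel xs (Assign x e) p q \<longleftrightarrow> q = map ((env xs p)(x := eval M (env xs p) e)) xs"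
| "alpha_rel xs (Seq S1 S2) p q \<longleftrightarrow>
     (\<exists>r. length r = length xs \<and> alpha_rel xs S1 p r \<and> alpha_rel xs S2 r q)"
| "alpha_rel xs (Cond b S1 S2) p q \<longleftrightarrow>
     (if bsat M (env xs p) b then alpha_rel xs S1 p q else alpha_rel xs S2 p q)"
| "alpha_rel xs (While b S0) p q \<longleftrightarrow>
     (\<exists>i w. run_rel (\<lambda>a b'. bsat M (env xs a) b \<and> alpha_rel xs S0 a b') w i p q) \<and>
     \<not> bsat M (env xs q) b"

lemma sat_alpha:
  assumes "distinct xs" and "prog_vars S \<subseteq> set xs"
    and "length us = length xs" and "length ys = length xs"
  shows "sat M v (alpha xs S us ys) \<longleftrightarrow> alpha_rel xs S (map v us) (map v ys)"
  using assms(2-)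
proof (induction S arbitrary: us ys v)
  case (Assign x e)
  have "eval M v (inst (ren xs us) e) = eval M (env xs (map v us)) e"
    unfolding eval_inst using Assign by (intro eval_cong) (auto simp: eval_ren env_upd)
  moreover have "map (env xs (map v us)) xs = map v us"
    unfolding env_def using Assign assms(1) by (intro map_upd) auto
  then have "env xs (map v us) (xs ! j) = v (us ! j)" if "j < length xs" for j
    using that Assign by (metis nth_map)
  ultimately have "sat M v (alpha xs (Assign x e) us ys) \<longleftrightarrow> (\<forall>j<length xs. v (ys ! j) =
      ((env xs (map v us))(x := eval M (env xs (map v us)) e)) (xs ! j))"
    by auto
  also have "\<dots> \<longleftrightarrow> alpha_rel xs (Assign x e) (map v us) (map v ys)"
    unfolding alpha_rel.simps using Assign by (subst list_eq_iff_nth_eq) simp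
  finally show ?case .
next
  case (Seq S1 S2)
  define m where "m = fresh (us @ ys)"
  define zs where "zs = [m ..< m + length xs]"
  have lt: "x \<in> set (us @ ys) \<Longrightarrow> x < m" for x
    unfolding m_def by (rule less_fresh)
  then have disj: "set us \<inter> set zs = {}" "set ys \<inter> set zs = {}"
    by (fastforce simp: zs_def)+
  have zs: "length zs = length xs" "distinct zs"
    by (auto simp: zs_def)
  have "sat M v (alpha xs (Seq S1 S2) us ys) \<longleftrightarrow>
      (\<exists>r. length r = length zs \<and> sat M (upd v zs r) (And (alpha xs S1 us zs) (alpha xs S2 zs ys)))"
    using zs by (simp add: Let_def sat_exs flip: m_def zs_def)
  also have "\<dots> \<longleftrightarrow> alpha_rel xs (Seq S1 S2) (map v us) (map v ys)"
    using Seq zs disj by (auto simp: map_upd map_upd_disjoint simp del: map_map)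
  finally show ?case .
next
  case (Cond b S1 S2)
  then show ?case by (simp add: sat_bexp_ren)
next
  case (While b S0)
  define i where "i = fresh (us @ ys)"
  have lt: "x \<in> set (us @ ys) \<Longrightarrow> x < i" for x
    unfolding i_def by (rule less_fresh)
  have step: "sat M v (And (bexp_fm (ren xs as) b) (alpha xs S0 as bs)) \<longleftrightarrow>
      bsat M (env xs (map v as)) b \<and> alpha_rel xs S0 (map v as) (map v bs)"
    if "length as = length us" "length bs = length us" for v as bs
    using that While by (simp add: sat_bexp_ren)
  have "i \<notin> set us" "i \<notin> set ys"
    using lt by fastforce+
  then show ?case
    using While.prems
    by (simp add: Let_def sat_bexp_ren
        sat_run_fm[where step = "\<lambda>a b'. bsat M (env xs a) b \<and> alpha_rel xs S0 a b'", OF step]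
        flip: i_def)
qed

lemma phi_holds_iff:
  assumes "distinct xs" and "prog_vars S \<subseteq> set xs" and "length a = length xs"
  shows "phi_holds M xs S v j a \<longleftrightarrow> (\<exists>w. run_rel (alpha_rel xs S) w j (map v xs) a)"
proof -
  define y where "y = fresh xs"
  define zs where "zs = [y + 1 ..< y + 1 + length xs]"
  have lt: "x \<in> set xs \<Longrightarrow> x < y" for x
    unfolding y_def by (rule less_fresh)
  have zs: "length zs = length xs" "distinct zs" "y \<notin> set zs"
    by (simp_all add: zs_def del: upt_Suc)
  let ?v = "upd v (y # zs) (j # a)"
  have "map ?v xs = map v xs"
    using lt by (intro map_upd_disjoint) (fastforce simp: zs_def)
  moreover have "map ?v (y # zs) = j # a"
    using zs assms(3) by (intro map_upd) auto
  ultimately show ?thesis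
    unfolding phi_holds_def phi_def Let_def y_def[symmetric] zs_def[symmetric]
    using zs assms
    by (simp add: sat_run_fm[where step = "alpha_rel xs S"] sat_alpha del: map_map upd_Cons map_eq_conv)
qed

end

section \<open>Comparison of the semantics\<close>

text \<open>Collects the variables of all terms, bound or free; this suffices both for agreement of
  assignments and for picking variables outside a formula.\<close>

primrec fm_vars :: "fm \<Rightarrow> var list" where
  "fm_vars (Eq s t) = tm_vars s @ tm_vars t"
| "fm_vars (Less s t) = tm_vars s @ tm_vars t"
| "fm_vars (Neg f) = fm_vars f"
| "fm_vars (And f g) = fm_vars f @ fm_vars g"
| "fm_vars (Or f g) = fm_vars f @ fm_vars g"
| "fm_vars (Imp f g) = fm_vars f @ fm_vars g"
| "fm_vars (All x f) = fm_vars f"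
| "fm_vars (Ex x f) = fm_vars f"

lemma sat_cong: "(\<And>x. x \<in> set (fm_vars f) \<Longrightarrow> v x = v' x) \<Longrightarrow> sat M v f \<longleftrightarrow> sat M v' f"
proof (induction f arbitrary: v v')
  case (Eq s t)
  then show ?case by (simp add: eval_cong[of _ v v'])
next
  case (Less s t)
  then show ?case by (simp add: eval_cong[of _ v v'])
next
  case (All x f)
  have "sat M (v(x := a)) f \<longleftrightarrow> sat M (v'(x := a)) f" for a
    using All.prems by (intro All.IH) simp
  then show ?case by simp
next
  case (Ex x f)
  have "sat M (v(x := a)) f \<longleftrightarrow> sat M (v'(x := a)) f" for a
    using Ex.prems by (intro Ex.IH) simp
  then show ?case by simp
next
  case (And f g)
  then show ?case by (metis Un_iff fm_vars.simps(4) sat.simps(4) set_append)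
next
  case (Or f g)
  then show ?case by (metis Un_iff fm_vars.simps(5) sat.simps(5) set_append)
next
  case (Imp f g)
  then show ?case by (metis Un_iff fm_vars.simps(6) sat.simps(6) set_append)
qed (metis fm_vars.simps(3) sat.simps(3))

context pa_model begin

section \<open>Coded paths of a step relation\<close>

lemma entry_rel_unique: "entry_rel a w j \<Longrightarrow> entry_rel b w j \<Longrightarrow> length a = length b \<Longrightarrow> a = b"
  unfolding entry_rel_def using beta_rel_unique tuple_rel_inject by metis

lemma run_rel_entry: "run_rel step w i p q \<Longrightarrow> entry_rel q w i"
  by (simp add: run_rel_def)

lemma run_rel_zero: "run_rel step w \<zero> p q \<longleftrightarrow> entry_rel p w \<zero> \<and> entry_rel q w \<zero>"
  by (simp add: run_rel_def not_less_zero)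

text \<open>The same code describes the shorter path. Entry \<open>k\<close> comes together with the
  step leaving it, which lets an induction along the path pass from \<open>k\<close> to its
  successor.\<close>

lemma run_rel_cut:
  assumes "run_rel step w i p q" and "k \<prec> i"
  shows "\<exists>a b. length a = length p \<and> length b = length p \<and> run_rel step w k p a \<and>
    entry_rel b w (k \<oplus> \<one>) \<and> step a b"
proof -
  have run: "entry_rel p w \<zero>" "\<And>j. j \<prec> i \<Longrightarrow> \<exists>a b. length a = length p \<and> length b = length p \<and>
      entry_rel a w j \<and> entry_rel b w (j \<oplus> \<one>) \<and> step a b"
    using assms(1) by (auto simp: run_rel_def)
  then obtain a b where "length a = length p" "length b = length p"
    "entry_rel a w k" "entry_rel b w (k \<oplus> \<one>)" "step a b"
    using assms(2) by blast
  moreover from this have "run_rel step w k p a"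
    unfolding run_rel_def using run ar.less_trans[OF _ assms(2)] by blast
  ultimately show ?thesis by blast
qed

lemma run_rel_prefix:
  assumes "run_rel step w i p q" and "k \<preceq> i" and "length q = length p"
  shows "\<exists>a. length a = length p \<and> run_rel step w k p a"
proof (cases "k = i")
  case False
  with assms(2) show ?thesis
    using run_rel_cut[OF assms(1)] by (auto simp: le_of_def)
qed (use assms in blast)

lemma run_rel_start: "\<exists>w. run_rel step w \<zero> p p"
  unfolding run_rel_zero entry_rel_def using tuple_rel_ex[of p] beta_rel_singleton by blast

text \<open>Goedel's lemma provides a code that keeps the entries up to \<open>i\<close> and adds
  \<open>r\<close>. Steps before \<open>i\<close> join two kept entries; the step at
  \<open>i\<close> leads from \<open>q\<close> to \<open>r\<close>.\<close>

lemma run_rel_extend: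
  assumes "run_rel step w i p q" and "step q r" and "length q = length p" and "length r = length p"
  shows "\<exists>w'. run_rel step w' (i \<oplus> \<one>) p r"
proof -
  obtain c where c: "tuple_rel r c"
    using tuple_rel_ex by blast
  obtain c0 where "beta_rel w i c0"
    using assms(1) by (auto simp: run_rel_def entry_rel_def)
  then obtain w' where w': "\<And>j r. j \<preceq> i \<Longrightarrow> beta_rel w j r \<Longrightarrow> beta_rel w' j r" "beta_rel w' (i \<oplus> \<one>) c"
    using beta_rel_extend[of w i c0 i c] by blast
  have keep: "entry_rel a w' j" if "entry_rel a w j" "j \<preceq> i" for a j
    using that w'(1) unfolding entry_rel_def by blast
  have new: "entry_rel r w' (i \<oplus> \<one>)"
    using c w'(2) unfolding entry_rel_def by blast
  have "\<exists>a b. length a = length p \<and> length b = length p \<and>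
      entry_rel a w' j \<and> entry_rel b w' (j \<oplus> \<one>) \<and> step a b" if "j \<prec> i \<oplus> \<one>" for j
  proof (cases "j = i")
    case True
    then show ?thesis
      using assms keep new run_rel_entry ar.order.refl by metis
  next
    case False
    with that have "j \<prec> i"
      by (simp add: less_succ_iff ar.le_less)
    moreover from this have "j \<preceq> i" "j \<oplus> \<one> \<preceq> i"
      by (simp_all add: less_iff_succ_le ar.less_imp_le flip: less_iff_succ_le)
    ultimately show ?thesis
      using assms(1) keep unfolding run_rel_def by metis
  qed
  moreover have "entry_rel p w' \<zero>"
    using assms(1) keep zero_le unfolding run_rel_def by blast
  ultimately show ?thesis
    using new unfolding run_rel_def by blast
qed

text \<open>Induction along the path shows that the two codes agree at each index up to
  \<open>i\<close>. The formula for this mentions only the codes and \<open>i\<close>, so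
  \<open>step\<close> may be any relation, definable or not.\<close>

lemma run_rel_unique:
  assumes w: "run_rel step w i p q" and w': "run_rel step w' i p q'"
    and len: "length q = length p" "length q' = length p" and "p \<noteq> []"
    and det: "\<And>a b b'. length a = length p \<Longrightarrow> length b = length p \<Longrightarrow> length b' = length p \<Longrightarrow>
      step a b \<Longrightarrow> step a b' \<Longrightarrow> b = b'"
  shows "q = q'"
proof -
  \<comment> \<open>Agreement is stated for the numbers coding the entries, which takes a single
    quantifier. Passing from equal vectors to equal numbers uses
    \<open>p \<noteq> []\<close>.\<close>
  define P where "P k \<longleftrightarrow> (k \<preceq> i \<longrightarrow> (\<exists>c. beta_rel w k c \<and> beta_rel w' k c))" for k
  have same: "\<exists>c. beta_rel w k c \<and> beta_rel w' k c"
    if "entry_rel a w k" "entry_rel a w' k" "length a = length p" for a k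
    using that \<open>p \<noteq> []\<close> tuple_rel_unique unfolding entry_rel_def by (metis length_0_conv)
  have same': "a = a'"
    if "entry_rel a w k" "entry_rel a' w' k" "length a = length a'" "beta_rel w k c" "beta_rel w' k c"
    for a a' k c
    using that beta_rel_unique tuple_rel_inject unfolding entry_rel_def by metis
  have "P i"
  proof (rule induct_fm[where P = P and v = "(\<lambda>_. w')(1 := i, 2 := w)" and x = 0
        and f = "Imp (Or (Less (Var 0) (Var 1)) (Eq (Var 0) (Var 1)))
          (Ex 4 (And (beta_fm 2 (Var 0) 4) (beta_fm 3 (Var 0) 4)))"])
    show "P \<zero>"
      using same w w' unfolding P_def run_rel_def by blast
  next
    fix k assume "P k"
    show "P (k \<oplus> \<one>)"
      unfolding P_def
    proof
      assume "k \<oplus> \<one> \<preceq> i"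
      then have k: "k \<prec> i"
        by (simp add: less_iff_succ_le)
      with \<open>P k\<close> obtain c where c: "beta_rel w k c" "beta_rel w' k c"
        unfolding P_def using ar.less_imp_le by blast
      obtain a b where a: "length a = length p" "length b = length p" "run_rel step w k p a"
        "entry_rel b w (k \<oplus> \<one>)" "step a b"
        using run_rel_cut[OF w k] by blast
      obtain a' b' where a': "length a' = length p" "length b' = length p" "run_rel step w' k p a'"
        "entry_rel b' w' (k \<oplus> \<one>)" "step a' b'"
        using run_rel_cut[OF w' k] by blast
      have "a = a'"
        using same' a a' c run_rel_entry by metis
      with det a a' have "b = b'" by blast
      with same a a' show "\<exists>c. beta_rel w (k \<oplus> \<one>) c \<and> beta_rel w' (k \<oplus> \<one>) c" by blast
    qed
  qed (simp add: P_def le_of_def)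
  then show ?thesis
    unfolding P_def using same' len run_rel_entry[OF w] run_rel_entry[OF w'] ar.order.refl by metis
qed

text \<open>Of two runs of a loop of different lengths, the longer one would satisfy the guard where the
  shorter one stops.\<close>

lemma alpha_rel_unique:
  assumes "xs \<noteq> []"
  shows "alpha_rel xs S p q \<Longrightarrow> alpha_rel xs S p q' \<Longrightarrow> length p = length xs \<Longrightarrow>
    length q = length xs \<Longrightarrow> length q' = length xs \<Longrightarrow> q = q'"
proof (induction S arbitrary: p q q')
  case (Seq S1 S2)
  then show ?case by (metis alpha_rel.simps(2))
next
  case (Cond b S1 S2)
  then show ?case by (metis alpha_rel.simps(3))
next
  case (While b S0)
  define step where "step a b' \<longleftrightarrow> bsat M (env xs a) b \<and> alpha_rel xs S0 a b'" for a b'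
  have det: "b' = b''" if "length a = length p" "length b' = length p" "length b'' = length p"
    "step a b'" "step a b''" for a b' b''
    using that While.IH While.prems unfolding step_def by metis
  have "p \<noteq> []" using assms While.prems by auto
  have not_less: "\<not> i \<prec> i'" if w: "run_rel step w i p r" "run_rel step w' i' p r'"
    "length r = length xs" "\<not> bsat M (env xs r) b" for i i' w w' r r'
  proof
    assume "i \<prec> i'"
    then obtain a b' where "length a = length p" "run_rel step w' i p a" "step a b'"
      using run_rel_cut[OF w(2)] by blast
    moreover from this have "r = a"
      using run_rel_unique[OF w(1), of w' a] w While.prems \<open>p \<noteq> []\<close> det by metis
    ultimately show False
      using w by (simp add: step_def)
  qed
  obtain i w i' w' where w: "run_rel step w i p q" "run_rel step w' i' p q'"
    and nb: "\<not> bsat M (env xs q) b" "\<not> bsat M (env xs q') b"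
    using While.prems unfolding alpha_rel.simps step_def[abs_def] by blast
  then have "i = i'"
    using not_less[OF w] not_less[OF w(2,1)] While.prems by (metis ar.neq_iff)
  with w show ?case
    using run_rel_unique[of step w i p q w' q'] While.prems \<open>p \<noteq> []\<close> det by metis
qed simp

section \<open>From the X-semantics to coded paths\<close>

lemma env_map: "x \<in> set xs \<Longrightarrow> env xs (map v xs) x = v x"
  using env_upd[of x xs "map v xs" v] by simp

lemma bsat_env_map: "set (bexp_vars b) \<subseteq> set xs \<Longrightarrow> bsat M (env xs (map v xs)) b \<longleftrightarrow> bsat M v b"
  by (rule bsat_cong) (auto intro: env_map)

text \<open>For each \<open>j\<close> the assumption yields a code of its own; by uniqueness the code for \<open>i\<close> serves
  for all of them.\<close>

lemma phi_holds_path: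
  assumes xs: "distinct xs" "xs \<noteq> []" "prog_vars S \<subseteq> set xs"
    and len: "\<And>j. j \<preceq> i \<Longrightarrow> length (a j) = length xs"
    and phi: "\<And>j. j \<preceq> i \<Longrightarrow> phi_holds M xs S v j (a j)"
  shows "\<exists>w. \<forall>j. j \<preceq> i \<longrightarrow> run_rel (alpha_rel xs S) w j (map v xs) (a j)"
proof -
  have run: "\<exists>w. run_rel (alpha_rel xs S) w j (map v xs) (a j)" if "j \<preceq> i" for j
    using that xs len phi phi_holds_iff by blast
  obtain w where w: "run_rel (alpha_rel xs S) w i (map v xs) (a i)"
    using run ar.order.refl by blast
  have "run_rel (alpha_rel xs S) w j (map v xs) (a j)" if j: "j \<preceq> i" for j
  proof -
    obtain e where e: "length e = length xs" "run_rel (alpha_rel xs S) w j (map v xs) e"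
      using run_rel_prefix[OF w j] len by auto
    obtain w' where "run_rel (alpha_rel xs S) w' j (map v xs) (a j)"
      using run[OF j] by blast
    from run_rel_unique[OF e(2) this] have "e = a j"
      using e(1) len[OF j] xs alpha_rel_unique[OF \<open>xs \<noteq> []\<close>, of S] by simp
    with e show ?thesis by simp
  qed
  then show ?thesis by blast
qed

text \<open>In the loop case the steps of the body come from the single code given by
  \<open>phi_holds_path\<close>, and the guards from the semantic clause. The lemma turns semantic
  steps into the steps by which coded paths are extended.\<close>

lemma Xsem_alpha_rel:
  assumes "distinct xs" and "xs \<noteq> []"
  shows "prog_vars S \<subseteq> set xs \<Longrightarrow> (v, v') \<in> Xsem M xs S \<Longrightarrow> alpha_rel xs S (map v xs) (map v' xs)"
proof (induction S arbitrary: v v')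
  case (Assign x e)
  have "eval M (env xs (map v xs)) e = eval M v e"
    using Assign by (intro eval_cong env_map) auto
  with Assign show ?case
    by (auto simp: env_map)
next
  case (Seq S1 S2)
  from Seq.prems obtain u where "(v, u) \<in> Xsem M xs S1" "(u, v') \<in> Xsem M xs S2"
    by auto
  with Seq have "alpha_rel xs S1 (map v xs) (map u xs)" "alpha_rel xs S2 (map u xs) (map v' xs)"
    by simp_all
  then show ?case
    by (auto intro!: exI[of _ "map u xs"])
next
  case (Cond b S1 S2)
  then show ?case by (auto simp: bsat_env_map)
next
  case (While b S0)
  from While.prems(2) obtain i a where
    len: "\<And>j. j \<preceq> i \<Longrightarrow> length (a j) = length xs" and
    phi: "\<And>j. j \<preceq> i \<Longrightarrow> phi_holds M xs S0 v j (a j)" and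
    b: "\<And>j. j \<prec> i \<Longrightarrow> bsat M (upd v xs (a j)) b" and
    v': "v' = upd v xs (a i)" "\<not> bsat M v' b"
    unfolding Xsem.simps mem_Collect_eq prod.case by blast
  obtain w where w: "\<And>j. j \<preceq> i \<Longrightarrow> run_rel (alpha_rel xs S0) w j (map v xs) (a j)"
    using phi_holds_path[OF assms, of S0 i a v] len phi While.prems by auto
  have a_i: "a i = map v' xs"
    unfolding v' using assms len by (simp add: map_upd le_of_def)
  have "run_rel (\<lambda>a b'. bsat M (env xs a) b \<and> alpha_rel xs S0 a b') w i (map v xs) (a i)"
    unfolding run_rel_def
  proof (intro conjI allI impI)
    fix j assume j: "j \<prec> i"
    obtain e e' where e: "length e = length xs" "length e' = length xs" "entry_rel e w j"
      "entry_rel e' w (j \<oplus> \<one>)" "alpha_rel xs S0 e e'"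
      using run_rel_cut[OF w[OF ar.order.refl] j] run_rel_entry by force
    \<comment> \<open>Both vectors are the entry of \<open>w\<close> at \<open>j\<close>, and an
      entry of given length is unique.\<close>
    moreover have "e = a j"
      using e w[of j] j run_rel_entry entry_rel_unique len ar.less_imp_le by metis
    moreover have "bsat M (env xs (a j)) b"
      using b[OF j] bsat_env[of b xs "a j" v] len ar.less_imp_le[OF j] While.prems by auto
    ultimately show "\<exists>a b'. length a = length (map v xs) \<and> length b' = length (map v xs) \<and>
        entry_rel a w j \<and> entry_rel b' w (j \<oplus> \<one>) \<and> bsat M (env xs a) b \<and> alpha_rel xs S0 a b'"
      by auto
  qed (use w[of i] in \<open>auto simp: run_rel_def\<close>)
  moreover have "\<not> bsat M (env xs (a i)) b"
    unfolding a_i using v'(2) While.prems by (simp add: bsat_env_map)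
  ultimately show ?case
    unfolding a_i by auto
qed

text \<open>The vector \<open>a k\<close> is the only one of its length coded at index
  \<open>k\<close> of \<open>w\<close>. Hence a property of \<open>k\<close> and \<open>a k\<close>
  becomes a formula about \<open>k\<close> with the additional parameters \<open>w\<close> and
  \<open>i\<close>, and the induction schema applies.\<close>

lemma path_continuous:
  assumes len: "\<And>j. j \<preceq> i \<Longrightarrow> length (a j) = n"
    and entry: "\<And>j. j \<preceq> i \<Longrightarrow> entry_rel (a j) w j"
  shows "M_continuous M n i a"
  unfolding M_continuous_def
proof (intro allI impI)
  fix f y zs u j
  assume dist: "distinct (y # zs)" and "length zs = n"
    and zero: "sat M (upd u (y # zs) (\<zero> # a \<zero>)) f"
    and step: "\<forall>j. j \<prec> i \<longrightarrow> sat M (upd u (y # zs) (j # a j)) f \<longrightarrow>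
      sat M (upd u (y # zs) ((j \<oplus> \<one>) # a (j \<oplus> \<one>))) f"
    and "j \<preceq> i"
  \<comment> \<open>\<open>W\<close> and its successor are variables outside \<open>f\<close>,
    \<open>y\<close> and \<open>zs\<close>; they hold the parameters \<open>w\<close> and
    \<open>i\<close>.\<close>
  define W where "W = fresh (y # zs @ fm_vars f)"
  have W: "x \<in> set (y # zs @ fm_vars f) \<Longrightarrow> x < W" for x
    unfolding W_def by (rule less_fresh)
  then have W': "W \<notin> set zs" "Suc W \<notin> set zs" "W \<noteq> y" "Suc W \<noteq> y"
    by fastforce+
  let ?v = "u(W := w, Suc W := i)"
  define P where "P k \<longleftrightarrow> (k \<preceq> i \<longrightarrow> sat M (upd u (y # zs) (k # a k)) f)" for k
  have "P j"
  proof (rule induct_fm[where P = P and v = ?v and x = y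
        and f = "Imp (Or (Less (Var y) (Var (Suc W))) (Eq (Var y) (Var (Suc W))))
          (exs zs (And (entry_fm zs W (Var y)) f))"])
    fix k
    have f: "sat M (upd (?v(y := k)) zs e) f \<longleftrightarrow> sat M (upd u (y # zs) (k # e)) f" for e
      using dist W' W by (intro sat_cong) (fastforce simp: upd_fun_upd)
    have "sat M (?v(y := k)) (exs zs (And (entry_fm zs W (Var y)) f)) \<longleftrightarrow>
        (\<exists>e. length e = n \<and> entry_rel e w k \<and> sat M (upd u (y # zs) (k # e)) f)"
      using dist W' \<open>length zs = n\<close>
      by (auto simp: sat_exs f upd_notin map_upd simp del: upd_Cons)
    moreover have "e = a k" if "length e = n" "entry_rel e w k" "k \<preceq> i" for e
      using that entry_rel_unique len entry by metis
    ultimately show "P k \<longleftrightarrow> sat M (?v(y := k)) (Imp (Or (Less (Var y) (Var (Suc W)))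
        (Eq (Var y) (Var (Suc W)))) (exs zs (And (entry_fm zs W (Var y)) f)))"
      using W' len entry by (auto simp: P_def le_of_def simp del: upd_Cons)
  next
    fix k assume "P k"
    then show "P (k \<oplus> \<one>)"
      unfolding P_def using step ar.less_imp_le by (metis less_iff_succ_le)
  qed (use zero in \<open>simp add: P_def\<close>)
  with \<open>j \<preceq> i\<close> show "sat M (upd u (y # zs) (j # a j)) f"
    by (simp add: P_def)
qed

lemma continuous_phi_holds:
  assumes xs: "distinct xs" "prog_vars S \<subseteq> set xs"
    and len: "\<And>j. j \<preceq> i \<Longrightarrow> length (a j) = length xs"
    and cont: "M_continuous M (length xs) i a" and start: "a \<zero> = map v xs"
    and step: "\<And>j. j \<prec> i \<Longrightarrow> alpha_rel xs S (a j) (a (j \<oplus> \<one>))"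
    and "j \<preceq> i"
  shows "phi_holds M xs S v j (a j)"
proof -
  \<comment> \<open>The same variables as in \<open>phi_holds\<close>, so that continuity can be
    applied to \<open>phi\<close> literally, with \<open>v\<close> supplying the parameters.\<close>
  define y where "y = fresh xs"
  define zs where "zs = [y + 1 ..< y + 1 + length xs]"
  have zs: "length zs = length xs" "distinct (y # zs)"
    by (simp_all add: zs_def del: upt_Suc)
  have phi: "phi_holds M xs S v j e \<longleftrightarrow> sat M (upd v (y # zs) (j # e)) (phi xs S xs y zs)" for j e
    by (simp only: phi_holds_def Let_def y_def zs_def)
  have "phi_holds M xs S v \<zero> (a \<zero>)"
    using xs start run_rel_start by (simp add: phi_holds_iff)
  moreover have "phi_holds M xs S v (j \<oplus> \<one>) (a (j \<oplus> \<one>))" if j: "j \<prec> i" "phi_holds M xs S v j (a j)" for j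
  proof -
    have le: "j \<preceq> i" "j \<oplus> \<one> \<preceq> i"
      using j by (simp_all add: ar.less_imp_le flip: less_iff_succ_le)
    then obtain w where "run_rel (alpha_rel xs S) w j (map v xs) (a j)"
      using j xs len by (auto simp: phi_holds_iff)
    from run_rel_extend[OF this step[OF j(1)]] show ?thesis
      using xs len le by (simp add: phi_holds_iff)
  qed
  ultimately show ?thesis
    using cont[unfolded M_continuous_def, rule_format, OF zs(2,1)] \<open>j \<preceq> i\<close>
    unfolding phi by blast
qed

text \<open>The list \<open>xs\<close> may contain more than the variables of \<open>S\<close>,
  since the induction keeps it fixed while passing to subprograms.\<close>

lemma Xsem_eq_Csem:
  assumes xs: "distinct xs" "xs \<noteq> []"
  shows "prog_vars S \<subseteq> set xs \<Longrightarrow> Xsem M xs S = Csem M xs S"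
proof (induction S)
  case (While b S0)
  then have IH: "Csem M xs S0 = Xsem M xs S0" and S0: "prog_vars S0 \<subseteq> set xs"
    by auto
  \<comment> \<open>Once the bodies agree by induction, the two loop clauses differ in one conjunct
    only; conjuncts they share serve as hypotheses for its equivalence.\<close>
  have "(\<forall>j. j \<preceq> i \<longrightarrow> phi_holds M xs S0 v j (a j)) \<longleftrightarrow> M_continuous M (length xs) i a"
    if len: "\<forall>j. j \<preceq> i \<longrightarrow> length (a j) = length xs"
      and start: "map v xs = a \<zero>"
      and step: "\<forall>j. j \<prec> i \<longrightarrow> bsat M (upd v xs (a j)) b \<and>
        (upd v xs (a j), upd v xs (a (j \<oplus> \<one>))) \<in> Xsem M xs S0"
    for v i a
  proof
    assume "\<forall>j. j \<preceq> i \<longrightarrow> phi_holds M xs S0 v j (a j)"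
    then obtain w where "\<And>j. j \<preceq> i \<Longrightarrow> run_rel (alpha_rel xs S0) w j (map v xs) (a j)"
      using phi_holds_path[OF xs S0] len by metis
    then show "M_continuous M (length xs) i a"
      using path_continuous len run_rel_entry by metis
  next
    assume cont: "M_continuous M (length xs) i a"
    have "alpha_rel xs S0 (a j) (a (j \<oplus> \<one>))" if j: "j \<prec> i" for j
    proof -
      have "j \<preceq> i" "j \<oplus> \<one> \<preceq> i"
        using j by (simp_all add: ar.less_imp_le flip: less_iff_succ_le)
      moreover have "alpha_rel xs S0 (map (upd v xs (a j)) xs) (map (upd v xs (a (j \<oplus> \<one>))) xs)"
        using Xsem_alpha_rel[OF xs S0] step j by blast
      ultimately show ?thesis
        using len xs(1) by (simp only: map_upd)
    qed
    then show "\<forall>j. j \<preceq> i \<longrightarrow> phi_holds M xs S0 v j (a j)"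
      using continuous_phi_holds[OF xs(1) S0 _ cont] len start by metis
  qed
  then show ?case
    unfolding Xsem.simps Csem.simps IH by blast
qed auto

end

text \<open>Every program contains an assignment, so its vectors are nonempty, which the uniqueness
  of their codes requires.\<close>

lemma prog_vars_nonempty: "prog_vars S \<noteq> {}"
  by (induction S) auto

theorem theorem4p3p6:
  fixes M :: "'a arith" and S :: prog and xs :: "var list"
  assumes "countable (UNIV :: 'a set)"
    and "models M PA"
    and "distinct xs" and "set xs = prog_vars S"
  shows "Xsem M xs S = Csem M xs S"
proof -
  interpret pa_model M
    using assms(2) by unfold_locales
  show ?thesis
    using assms(3,4) prog_vars_nonempty[of S] by (intro Xsem_eq_Csem) auto
qed

end
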